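(* Let $K$ be an infinite field and let $R=K[x_1,\ldots,x_s,y_1,\ldots,y_t,z_1,\ldots,z_r]$ with $s,r\ge1$ and $t\ge 0$. Let $\mathfrak{p}=(x_1,\dots,x_s,y_1,\dots,y_t)$ and $\mathfrak{q}=(y_1,\dots,y_t,z_1,\dots,z_r)$, and let $I=\mathfrak{p}^a\cap\mathfrak{q}^b$ for some integers $a,b\ge1$. Let $n=r+s+t$ be the dimension of $R$. Then $$\ell(I)=n-1.$$
   Context: The analytic spread of $I$ is $\ell(I)=\dim\left(R[It]\otimes_R R/\mathfrak m\right)$ (Krull dimension), where $R[It]$ is the Rees algebra and $\mathfrak m$ is the ideal generated by all the variables of $R$. *)

theory Defs
  imports
    "HOL-Algebra.UnivPoly"
    "HOL-Algebra.Ideal_Product"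
    "HOL-Algebra.QuotRing"
    "HOL-Algebra.Free_Abelian_Groups"
    "HOL-Library.Poly_Mapping"
    "HOL-Library.Extended_Nat"
begin

text \<open>
  \<open>K[x\<^sub>v | v \<in> 'v]\<close> for a finite type \<open>'v\<close> of variables: finitely supported functions from
  exponent vectors \<open>'v \<Rightarrow>\<^sub>0 nat\<close> to coefficients in \<open>'k\<close>, with the convolution product.
\<close>

definition mpoly_ring :: "(('v::finite \<Rightarrow>\<^sub>0 nat) \<Rightarrow>\<^sub>0 'k::field) ring"
  where "mpoly_ring = \<lparr>carrier = UNIV, monoid.mult = (*), one = 1, ring.zero = 0, add = (+)\<rparr>"

definition mpoly_var :: "'v::finite \<Rightarrow> (('v \<Rightarrow>\<^sub>0 nat) \<Rightarrow>\<^sub>0 'k::field)"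
  where "mpoly_var v = Poly_Mapping.single (Poly_Mapping.single v 1) 1"

text \<open>
  Powers of an ideal are taken in the semiring \<^const>\<open>ideals_set\<close> of ideals, so the
  zeroth power is the whole ring.
\<close>

abbreviation ideal_power :: "('a, 'm) ring_scheme \<Rightarrow> 'a set \<Rightarrow> nat \<Rightarrow> 'a set"
  where "ideal_power R I k \<equiv> I [^]\<^bsub>ideals_set R\<^esub> k"

text \<open>
  \<open>R[It]\<close>, the direct sum of all \<open>I\<^sup>k t\<^sup>k\<close>, as a subring of the univariate polynomial ring \<open>R[t]\<close>.
\<close>

definition rees_algebra :: "('a, 'm) ring_scheme \<Rightarrow> 'a set \<Rightarrow> ('a, nat \<Rightarrow> 'a) up_ring"
  where "rees_algebra R I =
    (UP R) \<lparr>carrier := {f \<in> carrier (UP R). \<forall>k. coeff (UP R) f k \<in> ideal_power R I k}\<rparr>"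

text \<open>
  The monoid ring \<open>\<int>[M]\<close>: its additive group is the free abelian group on \<open>M\<close>, and the
  product extends that of \<open>M\<close> biadditively.
\<close>

definition int_monoid_ring :: "('a, 'm) monoid_scheme \<Rightarrow> ('a \<Rightarrow>\<^sub>0 int) ring"
  where "int_monoid_ring M =
    \<lparr>carrier = carrier (free_Abelian_group (carrier M)),
     monoid.mult = (\<lambda>c d. frag_extend (\<lambda>x. frag_extend (\<lambda>y. frag_of (x \<otimes>\<^bsub>M\<^esub> y)) d) c),
     one = frag_of \<one>\<^bsub>M\<^esub>,
     ring.zero = 0,
     add = (+)\<rparr>"

text \<open>
  The tensor product \<open>A \<otimes>\<^sub>R B\<close> of two commutative \<open>R\<close>-algebras with structure maps
  \<open>\<phi> : R \<rightarrow> A\<close> and \<open>\<psi> : R \<rightarrow> B\<close>.  As an abelian group it is the free abelian group on the pairs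
  \<open>(a, b)\<close> modulo the subgroup generated by the relations below.  A product of a pair with a
  relation is again a relation, so this subgroup coincides with the ideal that the relations
  generate in the monoid ring \<open>\<int>[A \<times> B]\<close>, and the quotient carries the product
  \<open>(a \<otimes> b) (a' \<otimes> b') = a a' \<otimes> b b'\<close>.
\<close>

definition tensor_relations ::
    "('r, 'l) ring_scheme \<Rightarrow> ('a, 'm) ring_scheme \<Rightarrow> ('b, 'n) ring_scheme \<Rightarrow>
     ('r \<Rightarrow> 'a) \<Rightarrow> ('r \<Rightarrow> 'b) \<Rightarrow> ('a \<times> 'b \<Rightarrow>\<^sub>0 int) set"
  where "tensor_relations R A B \<phi> \<psi> =
      {frag_of (a \<oplus>\<^bsub>A\<^esub> a', b) - frag_of (a, b) - frag_of (a', b) | a a' b.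
         a \<in> carrier A \<and> a' \<in> carrier A \<and> b \<in> carrier B}
    \<union> {frag_of (a, b \<oplus>\<^bsub>B\<^esub> b') - frag_of (a, b) - frag_of (a, b') | a b b'.
         a \<in> carrier A \<and> b \<in> carrier B \<and> b' \<in> carrier B}
    \<union> {frag_of (\<phi> r \<otimes>\<^bsub>A\<^esub> a, b) - frag_of (a, \<psi> r \<otimes>\<^bsub>B\<^esub> b) | r a b.
         r \<in> carrier R \<and> a \<in> carrier A \<and> b \<in> carrier B}"

definition tensor_algebra ::
    "('r, 'l) ring_scheme \<Rightarrow> ('a, 'm) ring_scheme \<Rightarrow> ('b, 'n) ring_scheme \<Rightarrow>
     ('r \<Rightarrow> 'a) \<Rightarrow> ('r \<Rightarrow> 'b) \<Rightarrow> ('a \<times> 'b \<Rightarrow>\<^sub>0 int) set ring"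
  where "tensor_algebra R A B \<phi> \<psi> =
    int_monoid_ring (A \<times>\<times> B) Quot
      (Idl\<^bsub>int_monoid_ring (A \<times>\<times> B)\<^esub> (tensor_relations R A B \<phi> \<psi>))"

text \<open>
  Supremum of the lengths \<open>n\<close> of chains \<open>P\<^sub>0 \<subset> \<dots> \<subset> P\<^sub>n\<close> of prime ideals; for the zero ring,
  which has no prime ideals, this gives \<open>0\<close>.
\<close>

definition krull_dim :: "('a, 'm) ring_scheme \<Rightarrow> enat"
  where "krull_dim R =
    Sup {enat n | n. \<exists>P :: nat \<Rightarrow> 'a set.
      (\<forall>i\<le>n. primeideal (P i) R) \<and> (\<forall>i<n. P i \<subset> P (Suc i))}"

text \<open>
  \<open>dim (R[It] \<otimes>\<^sub>R R/\<mm>)\<close>, where \<open>R\<close> acts on \<open>R[It]\<close> through constant polynomials and on \<open>R/\<mm>\<close>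
  through the residue map.
\<close>

definition analytic_spread :: "('a, 'm) ring_scheme \<Rightarrow> 'a set \<Rightarrow> 'a set \<Rightarrow> enat"
  where "analytic_spread R \<mm> I =
    krull_dim (tensor_algebra R (rees_algebra R I) (R Quot \<mm>)
      (\<lambda>r. monom (UP R) r 0) (\<lambda>r. \<mm> +>\<^bsub>R\<^esub> r))"

end

theory Submission
  imports Defs "HOL-Computational_Algebra.Polynomial"
begin

text \<open>
  For monomial ideals everything is read off exponents: \<open>I\<^sup>k\<close> is spanned by the monomials whose
  degree in \<open>x, y\<close> is at least \<open>a k\<close> and whose degree in \<open>y, z\<close> is at least \<open>b k\<close>, and the ring in
  question is the quotient of the Rees algebra by the variables.

  Upper bound: the exponents \<open>(u, k)\<close> with \<open>k \<le> L\<close> that survive in this quotient lie in three families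
  with \<open>n - 1\<close> free coordinates each, so there are \<open>O(L\<^sup>n\<^sup>-\<^sup>1)\<close> of them.  As \<open>n\<close> elements have
  about \<open>L\<^sup>n\<close> power products, any \<open>n\<close> elements are algebraically dependent over \<open>K\<close>, whereas
  elements \<open>f\<^sub>i \<in> P\<^sub>i\<^sub>+\<^sub>1 - P\<^sub>i\<close> taken from a chain of \<open>n + 1\<close> primes would be independent.

  Lower bound: where both degree bounds are equalities, the exponents form a face, and restriction to
  this face is a ring homomorphism into \<open>R\<close>.  Pulling back the ideals generated by sets of variables
  gives a chain of \<open>n\<close> primes: the variables other than one \<open>x\<^sub>0\<close> and one \<open>z\<^sub>0\<close> are added one at a
  time, and \<open>x\<^sub>0\<close> and \<open>z\<^sub>0\<close> together in the last step.
\<close>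

subsection \<open>Polynomials and their exponents\<close>

abbreviation (input) lookup :: "('a \<Rightarrow>\<^sub>0 'b::zero) \<Rightarrow> 'a \<Rightarrow> 'b"
  where "lookup \<equiv> Poly_Mapping.lookup"

abbreviation (input) keys :: "('a \<Rightarrow>\<^sub>0 'b::zero) \<Rightarrow> 'a set"
  where "keys \<equiv> Poly_Mapping.keys"

text \<open>The projection onto the span of the monomials whose exponent satisfies \<open>P\<close>.
  It serves for picking leading terms, for setting variables to zero and for restricting to a
  face.\<close>

definition restr :: "('a \<Rightarrow> bool) \<Rightarrow> ('a \<Rightarrow>\<^sub>0 'b) \<Rightarrow> ('a \<Rightarrow>\<^sub>0 'b::zero)"
  where "restr P = Poly_Mapping.mapp (\<lambda>u c. c when P u)"

lemma lookup_restr: "lookup (restr P f) u = (lookup f u when P u)"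
  by (auto simp: restr_def lookup_mapp when_def in_keys_iff)

lemma keys_restr: "keys (restr P f) = {u \<in> keys f. P u}"
  by (auto simp: in_keys_iff lookup_restr when_def split: if_splits)

lemma restr_zero [simp]: "restr P 0 = 0"
  by (rule poly_mapping_eqI) (simp add: lookup_restr)

lemma restr_add: "restr P (f + g) = restr P f + restr P (g :: 'a \<Rightarrow>\<^sub>0 'b::monoid_add)"
  by (rule poly_mapping_eqI) (simp add: lookup_restr lookup_add when_def)

lemma restr_sum: "restr P (\<Sum>i\<in>A. f i) = (\<Sum>i\<in>A. restr P (f i :: 'a \<Rightarrow>\<^sub>0 'b::comm_monoid_add))"
  by (induction A rule: infinite_finite_induct) (simp_all add: restr_add)

lemma restr_split: "f = restr P f + restr (\<lambda>u. \<not> P u) (f :: 'a \<Rightarrow>\<^sub>0 'b::monoid_add)"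
  by (rule poly_mapping_eqI) (simp add: lookup_restr lookup_add when_def)

lemma restr_id: "(\<And>u. u \<in> keys f \<Longrightarrow> P u) \<Longrightarrow> restr P f = f"
  by (rule poly_mapping_eqI) (auto simp: lookup_restr when_def in_keys_iff)

lemma restr_eq_0: "(\<And>u. u \<in> keys f \<Longrightarrow> \<not> P u) \<Longrightarrow> restr P f = 0"
  by (rule poly_mapping_eqI) (auto simp: lookup_restr when_def in_keys_iff)

lemma restr_eq_0_iff: "restr P f = 0 \<longleftrightarrow> (\<forall>u\<in>keys f. \<not> P u)"
  by (metis (mono_tags, lifting) empty_iff keys_restr keys_zero mem_Collect_eq restr_eq_0)

lemma restr_single: "restr P (Poly_Mapping.single u c) = (Poly_Mapping.single u c when P u)"
  by (rule poly_mapping_eqI) (simp add: lookup_restr lookup_single when_def)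

lemma keys_mult_subset: "u \<in> keys (f * g) \<Longrightarrow> \<exists>p\<in>keys f. \<exists>q\<in>keys g. u = p + q"
  using keys_mult[of f g] by blast

text \<open>Split \<open>f\<close> by \<open>P1\<close> and \<open>g\<close> by \<open>P2\<close>:
  the hypothesis puts every exponent of the product of the two kept parts inside \<open>P3\<close>,
  and every exponent of the remaining products outside it.\<close>

lemma restr_mult_face:
  fixes f g :: "'a::monoid_add \<Rightarrow>\<^sub>0 'b::semiring_0"
  assumes face: "\<And>u w. u \<in> keys f \<Longrightarrow> w \<in> keys g \<Longrightarrow> P3 (u + w) \<longleftrightarrow> P1 u \<and> P2 w"
  shows "restr P3 (f * g) = restr P1 f * restr P2 g"
proof -
  let ?f1 = "restr P1 f" and ?f2 = "restr (\<lambda>u. \<not> P1 u) f"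
  let ?g1 = "restr P2 g" and ?g2 = "restr (\<lambda>u. \<not> P2 u) g"
  have "f * g = (?f1 + ?f2) * (?g1 + ?g2)"
    using restr_split[of f P1] restr_split[of g P2] by simp
  also have "\<dots> = ?f1 * ?g1 + (?f1 * ?g2 + ?f2 * g)"
    using restr_split[of g P2] by (metis add.assoc distrib_left distrib_right)
  finally have "restr P3 (f * g) = restr P3 (?f1 * ?g1) + (restr P3 (?f1 * ?g2) + restr P3 (?f2 * g))"
    by (simp only: restr_add)
  moreover have "restr P3 (?f1 * ?g1) = ?f1 * ?g1"
    by (rule restr_id) (auto dest!: keys_mult_subset simp: keys_restr face)
  moreover have "restr P3 (?f1 * ?g2) = 0"
    by (rule restr_eq_0) (auto dest!: keys_mult_subset simp: keys_restr face)
  moreover have "restr P3 (?f2 * g) = 0"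
    by (rule restr_eq_0) (auto dest!: keys_mult_subset simp: keys_restr face)
  ultimately show ?thesis by simp
qed

lemma restr_eq_single: "restr (\<lambda>w. w = u) f = Poly_Mapping.single u (lookup f u)"
  by (rule poly_mapping_eqI) (auto simp: lookup_restr lookup_single when_def)

lemma poly_mapping_sum_singles:
  fixes f :: "'a \<Rightarrow>\<^sub>0 'b::comm_monoid_add"
  shows "f = (\<Sum>u\<in>keys f. Poly_Mapping.single u (lookup f u))"
proof (rule poly_mapping_eqI)
  fix w
  have "(\<Sum>u\<in>keys f. lookup (Poly_Mapping.single u (lookup f u)) w) =
        (\<Sum>u\<in>keys f. if u = w then lookup f w else 0)"
    by (rule sum.cong) (auto simp: lookup_single when_def)
  then show "lookup f w = lookup (\<Sum>u\<in>keys f. Poly_Mapping.single u (lookup f u)) w"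
    by (simp add: lookup_sum in_keys_iff)
qed

section \<open>A monomial order and the absence of zero divisors\<close>

definition reindex :: "('v::finite \<Rightarrow> nat) \<Rightarrow> ('v \<Rightarrow>\<^sub>0 nat) \<Rightarrow> (nat \<Rightarrow>\<^sub>0 nat)"
  where "reindex e u = (\<Sum>v\<in>UNIV. Poly_Mapping.single (e v) (lookup u v))"

lemma reindex_add: "reindex e (u + w) = reindex e u + reindex e w"
  by (simp add: reindex_def lookup_add single_add sum.distrib)

lemma inj_reindex:
  assumes "inj e"
  shows "inj (reindex e)"
proof (rule injI, rule poly_mapping_eqI)
  have *: "lookup (reindex e u) (e v) = lookup u v" for u v
  proof -
    have "lookup (reindex e u) (e v) = (\<Sum>w\<in>UNIV. if w = v then lookup u v else 0)"
      unfolding reindex_def lookup_sum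
      by (rule sum.cong) (auto simp: lookup_single when_def inj_eq[OF assms])
    then show ?thesis by simp
  qed
  fix u w v assume "reindex e u = reindex e w"
  then show "lookup u v = lookup w v"
    using *[of u v] *[of w v] by simp
qed

text \<open>An injection of the variables into \<open>nat\<close> pulls the linear order of
  \<open>nat\<close>-indexed exponents back to an order compatible with addition. For it, the sum of
  the leading exponents of \<open>f\<close> and \<open>g\<close> arises in only one way, so the
  leading terms multiply without cancellation.\<close>

lemma mpoly_no_zero_divisors:
  fixes f g :: "('v::finite \<Rightarrow>\<^sub>0 nat) \<Rightarrow>\<^sub>0 'k::semiring_no_zero_divisors"
  assumes "f \<noteq> 0" "g \<noteq> 0"
  shows "f * g \<noteq> 0"
proof -
  obtain e :: "'v \<Rightarrow> nat" where e: "inj e"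
    using finite_imp_inj_to_nat_seg[of "UNIV :: 'v set"] by auto
  have ex: "\<exists>u\<in>keys h. \<forall>w\<in>keys h. reindex e w \<le> reindex e u" if "h \<noteq> 0"
    for h :: "('v \<Rightarrow>\<^sub>0 nat) \<Rightarrow>\<^sub>0 'k"
  proof -
    let ?M = "Max (reindex e ` keys h)"
    have "?M \<in> reindex e ` keys h"
      using that by (intro Max_in) (auto simp: poly_mapping_eq_iff fun_eq_iff in_keys_iff)
    then obtain u where u: "u \<in> keys h" "reindex e u = ?M"
      by (metis imageE)
    then show ?thesis
      by (intro bexI[of _ u]) auto
  qed
  obtain u where u: "u \<in> keys f" "\<And>w. w \<in> keys f \<Longrightarrow> reindex e w \<le> reindex e u"
    using ex[OF assms(1)] by blast
  obtain v where v: "v \<in> keys g" "\<And>w. w \<in> keys g \<Longrightarrow> reindex e w \<le> reindex e v"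
    using ex[OF assms(2)] by blast
  have "restr (\<lambda>w. w = u + v) (f * g) = restr (\<lambda>w. w = u) f * restr (\<lambda>w. w = v) g"
  proof (rule restr_mult_face)
    fix p q assume pq: "p \<in> keys f" "q \<in> keys g"
    have le: "reindex e p \<le> reindex e u" "reindex e q \<le> reindex e v"
      using u(2) v(2) pq by auto
    have "p = u \<and> q = v" if "p + q = u + v"
    proof -
      have eq: "reindex e p + reindex e q = reindex e u + reindex e v"
        using that by (metis reindex_add)
      \<comment> \<open>A strict inequality in one summand would make the inequality of the sums
        strict.\<close>
      have "reindex e p = reindex e u"
        by (metis add_mono_thms_linordered_field(3) add.commute eq le less_irrefl order_le_less)
      then have "p = u" using inj_reindex[OF e] by (simp add: inj_eq)
      then show ?thesis using that by simp
    qed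
    then show "p + q = u + v \<longleftrightarrow> p = u \<and> q = v" by auto
  qed
  also have "\<dots> = Poly_Mapping.single (u + v) (lookup f u * lookup g v)"
    by (simp add: restr_eq_single mult_single)
  also have "\<dots> \<noteq> 0"
    using u(1) v(1) by (metis in_keys_iff lookup_single_eq lookup_zero no_zero_divisors)
  finally show ?thesis by auto
qed

subsection \<open>Monomial ideals\<close>

definition deg_in :: "'v set \<Rightarrow> ('v \<Rightarrow>\<^sub>0 nat) \<Rightarrow> nat"
  where "deg_in V u = (\<Sum>v\<in>V. lookup u v)"

lemma deg_in_add: "deg_in V (u + w) = deg_in V u + deg_in V w"
  by (simp add: deg_in_def lookup_add sum.distrib)

lemma deg_in_zero [simp]: "deg_in V 0 = 0"
  by (simp add: deg_in_def)

lemma deg_in_single: "deg_in V (Poly_Mapping.single v c) = (c when v \<in> (V :: 'v::finite set))"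
  by (simp add: deg_in_def lookup_single when_def)

lemma deg_in_Un: "V \<inter> W = {} \<Longrightarrow> deg_in (V \<union> W) u = deg_in V u + deg_in (W :: 'v::finite set) u"
  by (simp add: deg_in_def sum.union_disjoint)

lemma single_split:
  fixes u :: "'v \<Rightarrow>\<^sub>0 nat"
  assumes "lookup u v \<noteq> 0"
  obtains w where "u = Poly_Mapping.single v 1 + w"
proof
  show "u = Poly_Mapping.single v 1 + (u - Poly_Mapping.single v 1)"
    using assms by (intro poly_mapping_eqI) (auto simp: lookup_add lookup_minus lookup_single when_def)
qed

lemma deg_in_pos_split:
  assumes "deg_in V u > 0"
  obtains v w where "v \<in> V" "u = Poly_Mapping.single v 1 + w"
proof -
  obtain v where v: "v \<in> V" "lookup u v \<noteq> 0"
    using assms unfolding deg_in_def by (metis (no_types, lifting) less_irrefl sum.neutral)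
  from v(2) show ?thesis
    by (rule single_split) (use v(1) that in blast)
qed

text \<open>Variables of \<open>V\<close> are moved from the rest \<open>w\<close> to
  \<open>v\<close> one at a time; one is available as long as the degree of \<open>v\<close> is
  below that of \<open>u\<close>.\<close>

lemma deg_in_split:
  assumes "j \<le> deg_in V (u :: 'v::finite \<Rightarrow>\<^sub>0 nat)"
  obtains v w where "u = v + w" "keys v \<subseteq> V" "deg_in V v = j"
proof -
  have "\<exists>v w. u = v + w \<and> keys v \<subseteq> V \<and> deg_in V v = j"
    using assms
  proof (induction j)
    case 0
    show ?case by (rule exI[of _ 0], rule exI[of _ u]) simp
  next
    case (Suc j)
    then obtain v w where vw: "u = v + w" "keys v \<subseteq> V" "deg_in V v = j" by auto
    then have "deg_in V w > 0" using Suc.prems by (simp add: deg_in_add)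
    then obtain x w' where x: "x \<in> V" "w = Poly_Mapping.single x 1 + w'"
      by (rule deg_in_pos_split)
    have "keys (v + Poly_Mapping.single x 1) \<subseteq> V"
      using keys_add[of v "Poly_Mapping.single x 1"] vw(2) x(1) by auto
    moreover have "deg_in V (v + Poly_Mapping.single x 1) = Suc j"
      using vw x by (simp add: deg_in_add deg_in_single)
    moreover have "u = (v + Poly_Mapping.single x 1) + w'"
      using vw x by (simp add: add.assoc)
    ultimately show ?case by blast
  qed
  then show ?thesis using that by blast
qed

lemma deg_in_eq_0: "keys v \<subseteq> W \<Longrightarrow> V \<inter> W = {} \<Longrightarrow> deg_in V v = 0"
  unfolding deg_in_def by (intro sum.neutral) (auto simp: in_keys_iff)

definition up_closed :: "'a::plus set \<Rightarrow> bool"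
  where "up_closed U \<longleftrightarrow> (\<forall>u\<in>U. \<forall>w. u + w \<in> U)"

text \<open>The span of the monomials with exponent in \<open>U\<close>, an ideal once
  \<open>U\<close> is closed upwards. Products and powers of such ideals reduce to sums of sets of
  exponents.\<close>

definition mon_ideal :: "('v \<Rightarrow>\<^sub>0 nat) set \<Rightarrow> (('v::finite \<Rightarrow>\<^sub>0 nat) \<Rightarrow>\<^sub>0 'k::field) set"
  where "mon_ideal U = {f. keys f \<subseteq> U}"

lemma mon_ideal_single: "u \<in> U \<Longrightarrow> Poly_Mapping.single u c \<in> mon_ideal U"
  by (auto simp: mon_ideal_def)

lemma mon_ideal_zero [simp]: "0 \<in> mon_ideal U"
  by (simp add: mon_ideal_def)

lemma mon_ideal_add: "f \<in> mon_ideal U \<Longrightarrow> g \<in> mon_ideal U \<Longrightarrow> f + g \<in> mon_ideal U"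
  unfolding mon_ideal_def mem_Collect_eq by (rule order_trans[OF Poly_Mapping.keys_add]) simp

lemma mon_ideal_sum: "(\<And>i. i \<in> A \<Longrightarrow> f i \<in> mon_ideal U) \<Longrightarrow> (\<Sum>i\<in>A. f i) \<in> mon_ideal U"
  by (induction A rule: infinite_finite_induct) (auto intro: mon_ideal_add)

lemma mon_ideal_mult:
  "f \<in> mon_ideal U \<Longrightarrow> g \<in> mon_ideal V \<Longrightarrow> (\<And>u v. u \<in> U \<Longrightarrow> v \<in> V \<Longrightarrow> u + v \<in> W)
    \<Longrightarrow> f * g \<in> mon_ideal W"
  unfolding mon_ideal_def mem_Collect_eq
proof
  fix w assume *: "keys f \<subseteq> U" "keys g \<subseteq> V" "\<And>u v. u \<in> U \<Longrightarrow> v \<in> V \<Longrightarrow> u + v \<in> W" "w \<in> keys (f * g)"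
  then obtain p q where "p \<in> keys f" "q \<in> keys g" "w = p + q"
    using keys_mult_subset by blast
  then show "w \<in> W" using * by blast
qed

lemma mpoly_ring_simps [simp]:
  "carrier mpoly_ring = UNIV"
  "x \<otimes>\<^bsub>mpoly_ring\<^esub> y = x * y" "\<one>\<^bsub>mpoly_ring\<^esub> = 1"
  "\<zero>\<^bsub>mpoly_ring\<^esub> = 0" "x \<oplus>\<^bsub>mpoly_ring\<^esub> y = x + y"
  by (simp_all add: mpoly_ring_def)

lemma cring_mpoly_ring: "cring (mpoly_ring :: (('v::finite \<Rightarrow>\<^sub>0 nat) \<Rightarrow>\<^sub>0 'k::field) ring)"
  (is "cring ?R")
proof (rule cringI)
  show "abelian_group ?R"
  proof (rule abelian_groupI)
    fix x :: "('v \<Rightarrow>\<^sub>0 nat) \<Rightarrow>\<^sub>0 'k"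
    show "\<exists>y\<in>carrier ?R. y \<oplus>\<^bsub>?R\<^esub> x = \<zero>\<^bsub>?R\<^esub>"
      by (rule bexI[of _ "- x"]) simp_all
  qed (simp_all add: algebra_simps)
  show "comm_monoid ?R"
    by (rule comm_monoidI) (simp_all add: algebra_simps)
qed (simp add: algebra_simps)

lemma mpoly_a_inv [simp]: "\<ominus>\<^bsub>mpoly_ring\<^esub> x = - x"
proof -
  interpret cring mpoly_ring by (rule cring_mpoly_ring)
  show ?thesis by (rule minus_equality) simp_all
qed

lemma ideal_mpoly_ringI:
  assumes "0 \<in> I" "\<And>x y. x \<in> I \<Longrightarrow> y \<in> I \<Longrightarrow> x + y \<in> I" "\<And>x y. x \<in> I \<Longrightarrow> y * x \<in> I"
  shows "ideal I mpoly_ring"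
proof (rule idealI)
  interpret cring mpoly_ring by (rule cring_mpoly_ring)
  show "ring mpoly_ring" by (rule ring_axioms)
  show "subgroup I (add_monoid mpoly_ring)"
  proof (rule add.subgroupI)
    fix x assume "x \<in> I"
    then show "\<ominus>\<^bsub>mpoly_ring\<^esub> x \<in> I" using assms(3)[of x "-1"] by simp
  qed (use assms in auto)
qed (use assms in \<open>auto simp: mult.commute\<close>)

lemma ideal_mon_ideal:
  assumes "up_closed U"
  shows "ideal (mon_ideal U) mpoly_ring"
proof (rule ideal_mpoly_ringI)
  fix x y :: "('a \<Rightarrow>\<^sub>0 nat) \<Rightarrow>\<^sub>0 'b" assume "x \<in> mon_ideal U"
  moreover have "y \<in> mon_ideal UNIV" by (simp add: mon_ideal_def)
  ultimately have "x * y \<in> mon_ideal U"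
    by (rule mon_ideal_mult) (use assms in \<open>auto simp: up_closed_def\<close>)
  then show "y * x \<in> mon_ideal U" by (simp add: mult.commute)
qed (auto intro: mon_ideal_add)

lemma ideal_sum_mem:
  assumes I: "ideal I mpoly_ring" and f: "\<And>i. i \<in> A \<Longrightarrow> f i \<in> I"
  shows "(\<Sum>i\<in>A. f i) \<in> I"
proof -
  have 0: "0 \<in> I"
    using additive_subgroup.zero_closed[OF ideal.axioms(1)[OF I]] by simp
  have add: "x + y \<in> I" if "x \<in> I" "y \<in> I" for x y
    using additive_subgroup.a_closed[OF ideal.axioms(1)[OF I] that] by simp
  show ?thesis
    using f by (induction A rule: infinite_finite_induct) (simp_all add: 0 add)
qed

lemma mon_ideal_subset_ideal:
  fixes I :: "(('v::finite \<Rightarrow>\<^sub>0 nat) \<Rightarrow>\<^sub>0 'k::field) set"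
  assumes "ideal I mpoly_ring" "\<And>u c. u \<in> U \<Longrightarrow> Poly_Mapping.single u c \<in> I"
  shows "mon_ideal U \<subseteq> I"
proof
  fix f :: "('v \<Rightarrow>\<^sub>0 nat) \<Rightarrow>\<^sub>0 'k" assume "f \<in> mon_ideal U"
  then have "(\<Sum>u\<in>keys f. Poly_Mapping.single u (lookup f u)) \<in> I"
    using assms by (intro ideal_sum_mem) (auto simp: mon_ideal_def)
  then show "f \<in> I" by (subst poly_mapping_sum_singles)
qed

text \<open>Exponents of a product are sums of exponents of the factors, which gives one inclusion.
  For the other it suffices to write a term with exponent \<open>u + v\<close> as a product of two
  terms.\<close>

lemma ideal_prod_mon_ideal:
  assumes U: "up_closed U" and V: "up_closed V"
  shows "ideal_prod mpoly_ring (mon_ideal U) (mon_ideal V) = mon_ideal {u + v | u v. u \<in> U \<and> v \<in> V}"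
    (is "?L = ?R")
proof
  interpret cring mpoly_ring by (rule cring_mpoly_ring)
  show "?L \<subseteq> ?R"
  proof
    fix x assume "x \<in> ?L"
    then show "x \<in> ?R"
    proof induction
      case (prod i j)
      then show ?case
        unfolding mpoly_ring_simps by (rule mon_ideal_mult) blast
    next
      case (sum s1 s2)
      show ?case
        unfolding mpoly_ring_simps using sum(3,4) by (rule mon_ideal_add)
    qed
  qed
  have "ideal ?L mpoly_ring"
    using assms by (intro ideal_prod_is_ideal ideal_mon_ideal)
  then show "?R \<subseteq> ?L"
  proof (rule mon_ideal_subset_ideal)
    fix w :: "'a \<Rightarrow>\<^sub>0 nat" and c :: 'b assume "w \<in> {u + v | u v. u \<in> U \<and> v \<in> V}"
    then obtain u v where uv: "w = u + v" "u \<in> U" "v \<in> V" by auto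
    have "Poly_Mapping.single u c \<otimes>\<^bsub>mpoly_ring\<^esub> Poly_Mapping.single v 1 \<in> ?L"
      using uv by (intro ideal_prod.prod mon_ideal_single)
    then show "Poly_Mapping.single w c \<in> ?L"
      by (simp add: mult_single uv)
  qed
qed

text \<open>A monomial is a multiple of some variable from \<open>V\<close> exactly if its degree in
  \<open>V\<close> is positive.\<close>

lemma genideal_vars: "Idl\<^bsub>mpoly_ring\<^esub> (mpoly_var ` V) = mon_ideal {u. 1 \<le> deg_in V u}" (is "?L = ?R")
proof
  interpret cring mpoly_ring by (rule cring_mpoly_ring)
  have up: "up_closed {u. 1 \<le> deg_in V u}" by (auto simp: up_closed_def deg_in_add)
  show "?L \<subseteq> ?R"
  proof (rule genideal_minimal[OF ideal_mon_ideal[OF up]])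
    show "mpoly_var ` V \<subseteq> mon_ideal {u. 1 \<le> deg_in V u}"
      unfolding mpoly_var_def image_subset_iff by (simp add: mon_ideal_single deg_in_single)
  qed
  have id: "ideal ?L mpoly_ring" by (rule genideal_ideal) (simp only: mpoly_ring_simps subset_UNIV)
  then show "?R \<subseteq> ?L"
  proof (rule mon_ideal_subset_ideal)
    fix u :: "'a \<Rightarrow>\<^sub>0 nat" and c :: 'b assume "u \<in> {u. 1 \<le> deg_in V u}"
    then have "0 < deg_in V u" by simp
    then obtain v w where vw: "v \<in> V" "u = Poly_Mapping.single v 1 + w"
      by (rule deg_in_pos_split)
    have "mpoly_var v \<in> ?L" 
      using genideal_self[of "mpoly_var ` V"] vw(1) unfolding mpoly_ring_simps by blast
    then have "mpoly_var v \<otimes>\<^bsub>mpoly_ring\<^esub> Poly_Mapping.single w c \<in> ?L"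
      by (rule ideal.I_r_closed[OF id]) simp
    then show "Poly_Mapping.single u c \<in> ?L"
      by (simp add: mpoly_var_def mult_single vw)
  qed
qed

text \<open>\<open>U\<close> prescribes the exponents of every power in advance, with
  \<open>U 0\<close> for the unit ideal; the induction then only needs that adding exponents of the
  first power leads exactly from each level to the next.\<close>

lemma ideal_power_mon_ideal:
  assumes "\<And>k. up_closed (U k)" "U 0 = UNIV"
    and "\<And>k. {u + v | u v. u \<in> U k \<and> v \<in> U 1} = U (Suc k)"
  shows "ideal_power mpoly_ring (mon_ideal (U 1)) k = mon_ideal (U k)"
proof (induction k)
  case 0
  interpret I: comm_monoid "ideals_set (mpoly_ring :: (('a \<Rightarrow>\<^sub>0 nat) \<Rightarrow>\<^sub>0 'b) ring)"
    by (rule cring.ideals_set_is_comm_monoid[OF cring_mpoly_ring])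
  have "\<one>\<^bsub>ideals_set mpoly_ring\<^esub> = (mon_ideal UNIV :: (('a \<Rightarrow>\<^sub>0 nat) \<Rightarrow>\<^sub>0 'b) set)"
    by (simp add: ideals_set_def mon_ideal_def)
  then show ?case
    unfolding I.nat_pow_0 assms(2) .
next
  case (Suc k)
  interpret I: comm_monoid "ideals_set (mpoly_ring :: (('a \<Rightarrow>\<^sub>0 nat) \<Rightarrow>\<^sub>0 'b) ring)"
    by (rule cring.ideals_set_is_comm_monoid[OF cring_mpoly_ring])
  have "ideal_power mpoly_ring (mon_ideal (U 1)) (Suc k) =
      ideal_prod mpoly_ring (mon_ideal (U k)) (mon_ideal (U 1) :: (('a \<Rightarrow>\<^sub>0 nat) \<Rightarrow>\<^sub>0 'b) set)"
    unfolding I.nat_pow_Suc Suc by (simp add: ideals_set_def)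
  also have "\<dots> = mon_ideal (U (Suc k))"
    using ideal_prod_mon_ideal[OF assms(1) assms(1), of k 1] unfolding assms(3) .
  finally show ?case .
qed

lemma ideal_power_vars:
  "ideal_power mpoly_ring (Idl\<^bsub>mpoly_ring\<^esub> (mpoly_var ` V)) k = mon_ideal {u. k \<le> deg_in V u}"
  unfolding genideal_vars
proof (rule ideal_power_mon_ideal[of "\<lambda>k. {u. k \<le> deg_in V u}"])
  fix k
  have "\<exists>u v. w = u + v \<and> k \<le> deg_in V u \<and> 1 \<le> deg_in V v" if "Suc k \<le> deg_in V w"
    for w :: "'a \<Rightarrow>\<^sub>0 nat"
  proof -
    have "0 < deg_in V w" using that by simp
    then obtain v u where vu: "v \<in> V" "w = Poly_Mapping.single v 1 + u"
      by (rule deg_in_pos_split)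
    then have "k \<le> deg_in V u" "1 \<le> deg_in V (Poly_Mapping.single v 1)"
      using that by (auto simp: deg_in_add deg_in_single)
    then show ?thesis using vu add.commute by blast
  qed
  then show "{u + v |u v. u \<in> {u. k \<le> deg_in V u} \<and> v \<in> {u. 1 \<le> deg_in V u}} = {u. Suc k \<le> deg_in V u}"
    by (auto simp: deg_in_add)
qed (auto simp: up_closed_def deg_in_add)

section \<open>Powers of the ideal I\<close>

definition rees_exps :: "'v set \<Rightarrow> 'v set \<Rightarrow> nat \<Rightarrow> nat \<Rightarrow> nat \<Rightarrow> ('v \<Rightarrow>\<^sub>0 nat) set"
  where "rees_exps P Q a b k = {u. a * k \<le> deg_in P u \<and> b * k \<le> deg_in Q u}"

lemma up_closed_rees_exps: "up_closed (rees_exps P Q a b k)"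
  by (auto simp: up_closed_def rees_exps_def deg_in_add)

text \<open>Variables of \<open>Y\<close> count for both degrees. The part \<open>w\<close> split
  off takes \<open>j\<close> of them and is filled up with \<open>a - j\<close> variables from
  \<open>X\<close> and \<open>b - j\<close> from \<open>Z\<close>; the point is to choose
  \<open>j\<close> so that the rest still meets the bounds for \<open>k\<close>.\<close>

lemma rees_exps_Suc_split:
  fixes X Y Z :: "'v::finite set"
  assumes disj: "X \<inter> Y = {}" "X \<inter> Z = {}" "Y \<inter> Z = {}"
    and u: "u \<in> rees_exps (X \<union> Y) (Y \<union> Z) a b (Suc k)"
  shows "\<exists>v w. u = v + w \<and> v \<in> rees_exps (X \<union> Y) (Y \<union> Z) a b k \<and> w \<in> rees_exps (X \<union> Y) (Y \<union> Z) a b 1"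
proof -
  note deg_Un = deg_in_Un[OF disj(1)] deg_in_Un[OF disj(3)]
  define \<alpha> \<beta> \<gamma> where abc: "\<alpha> = deg_in X u" "\<beta> = deg_in Y u" "\<gamma> = deg_in Z u"
  \<comment> \<open>The least number of \<open>Y\<close>-variables for which \<open>X\<close> and
    \<open>Z\<close> can supply what is missing. Subtraction is truncated: \<open>j\<close> may be
    0, and it may exceed one of \<open>a\<close> and \<open>b\<close>.\<close>
  define j where "j = max (a - \<alpha>) (b - \<gamma>)"
  have ge: "a * k + a \<le> \<alpha> + \<beta>" "b * k + b \<le> \<beta> + \<gamma>"
    using u by (auto simp: rees_exps_def deg_Un abc)
  \<comment> \<open>Naming the products keeps the estimates below linear.\<close>
  define A B where AB: "A = a * k" "B = b * k"
  have cmp: "a \<le> b \<and> A \<le> B \<or> b \<le> a \<and> B \<le> A"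
    using linear[of a b] by (auto simp: AB)
  have geAB: "A + a \<le> \<alpha> + \<beta>" "B + b \<le> \<beta> + \<gamma>"
    using ge by (simp_all add: AB)
  have lower: "a \<le> j + \<alpha>" "b \<le> j + \<gamma>"
    by (simp_all add: j_def flip: le_diff_conv)
  have "j = 0 \<or> j + \<alpha> = a \<or> j + \<gamma> = b"
    by (auto simp: j_def max_def)
  \<comment> \<open>If \<open>j + \<gamma> = b\<close>, then \<open>B + j \<le> \<beta>\<close>;
    this gives the bound with \<open>A\<close> when \<open>A \<le> B\<close>, and otherwise
    \<open>j \<le> b \<le> a\<close> does. The case \<open>j + \<alpha> = a\<close> is
    symmetric.\<close>
  then have upper: "j \<le> \<beta>" "A + j \<le> \<alpha> + \<beta>" "B + j \<le> \<beta> + \<gamma>"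
    using cmp geAB by (elim disjE; linarith)+
  \<comment> \<open>The last two bounds matter when \<open>j\<close> exceeds \<open>a\<close> or
    \<open>b\<close>: the part split off then has degree \<open>j\<close> in place of
    \<open>a\<close> or \<open>b\<close>.\<close>
  have j: "a - j \<le> \<alpha>" "j \<le> \<beta>" "b - j \<le> \<gamma>" "a * k + j \<le> \<alpha> + \<beta>" "b * k + j \<le> \<beta> + \<gamma>"
    using lower upper by (simp_all add: AB le_diff_conv add.commute)
  obtain vy w1 where vy: "u = vy + w1" "keys vy \<subseteq> Y" "deg_in Y vy = j"
    using deg_in_split[of j Y u] j abc by auto
  have "deg_in X vy = 0" "deg_in Z vy = 0"
    using deg_in_eq_0[OF vy(2)] disj by auto
  note vy = vy this
  obtain vx w2 where vx: "w1 = vx + w2" "keys vx \<subseteq> X" "deg_in X vx = a - j"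
    using deg_in_split[of "a - j" X w1] j abc vy by (auto simp: deg_in_add)
  have "deg_in Y vx = 0" "deg_in Z vx = 0"
    using deg_in_eq_0[OF vx(2)] disj by auto
  note vx = vx this
  obtain vz w3 where vz: "w2 = vz + w3" "keys vz \<subseteq> Z" "deg_in Z vz = b - j"
    using deg_in_split[of "b - j" Z w2] j abc vy vx by (auto simp: deg_in_add)
  have "deg_in X vz = 0" "deg_in Y vz = 0"
    using deg_in_eq_0[OF vz(2)] disj by auto
  note vz = vz this
  have "u = w3 + (vx + vy + vz)"
    using vx vy vz by (simp add: ac_simps)
  moreover have "vx + vy + vz \<in> rees_exps (X \<union> Y) (Y \<union> Z) a b 1"
    using vx vy vz by (auto simp: rees_exps_def deg_Un deg_in_add)
  moreover have "w3 \<in> rees_exps (X \<union> Y) (Y \<union> Z) a b k"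
    using abc vx vy vz j ge by (auto simp: rees_exps_def deg_Un deg_in_add)
  ultimately show ?thesis by blast
qed

text \<open>On exponents, intersecting the two powers gives level 1, and
  \<open>rees_exps_Suc_split\<close> is the nontrivial inclusion from each level to the next. So the
  powers of \<open>I\<close> are again intersections of powers of the two ideals.\<close>

lemma ideal_power_rees_exps:
  fixes X Y Z :: "'v::finite set" and I :: "(('v \<Rightarrow>\<^sub>0 nat) \<Rightarrow>\<^sub>0 'k::field) set"
  assumes disj: "X \<inter> Y = {}" "X \<inter> Z = {}" "Y \<inter> Z = {}"
    and I: "I = ideal_power mpoly_ring (Idl\<^bsub>mpoly_ring\<^esub> (mpoly_var ` (X \<union> Y))) a
              \<inter> ideal_power mpoly_ring (Idl\<^bsub>mpoly_ring\<^esub> (mpoly_var ` (Y \<union> Z))) b"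
  shows "ideal_power mpoly_ring I k = mon_ideal (rees_exps (X \<union> Y) (Y \<union> Z) a b k)"
proof -
  let ?U = "rees_exps (X \<union> Y) (Y \<union> Z) a b"
  have I1: "I = mon_ideal (?U 1)"
    unfolding I ideal_power_vars by (auto simp: mon_ideal_def rees_exps_def)
  have "{u + v |u v. u \<in> ?U k \<and> v \<in> ?U 1} = ?U (Suc k)" for k
  proof
    show "{u + v |u v. u \<in> ?U k \<and> v \<in> ?U 1} \<subseteq> ?U (Suc k)"
      by (auto simp: rees_exps_def deg_in_add)
    show "?U (Suc k) \<subseteq> {u + v |u v. u \<in> ?U k \<and> v \<in> ?U 1}"
      using rees_exps_Suc_split[OF disj] by blast
  qed
  then show ?thesis
    unfolding I1 by (intro ideal_power_mon_ideal up_closed_rees_exps) (simp_all add: rees_exps_def)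
qed

subsection \<open>Monoid rings and tensor products\<close>

text \<open>The product of \<open>int_monoid_ring\<close> under a name of its own. It is biadditive,
  so by \<open>frag_induction\<close> its laws reduce to generators, where they are those of
  \<open>M\<close>.\<close>

definition frag_mult :: "('a, 'm) monoid_scheme \<Rightarrow> ('a \<Rightarrow>\<^sub>0 int) \<Rightarrow> ('a \<Rightarrow>\<^sub>0 int) \<Rightarrow> ('a \<Rightarrow>\<^sub>0 int)"
  where "frag_mult M c d = frag_extend (\<lambda>x. frag_extend (\<lambda>y. frag_of (x \<otimes>\<^bsub>M\<^esub> y)) d) c"

lemma frag_mult_of [simp]: "frag_mult M (frag_of x) (frag_of y) = frag_of (x \<otimes>\<^bsub>M\<^esub> y)"
  by (simp add: frag_mult_def)

lemma frag_mult_0 [simp]: "frag_mult M 0 d = 0" "frag_mult M c 0 = 0"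
  by (simp_all add: frag_mult_def frag_extend_eq_0)

lemma frag_mult_diff_left: "frag_mult M (c - c') d = frag_mult M c d - frag_mult M c' d"
  by (simp add: frag_mult_def frag_extend_diff)

lemma frag_mult_diff_right: "frag_mult M c (d - d') = frag_mult M c d - frag_mult M c d'"
  using subset_UNIV
proof (induction c rule: frag_induction)
  case (diff a b)
  then show ?case unfolding frag_mult_diff_left by (simp add: algebra_simps)
qed (simp_all add: frag_mult_def frag_extend_diff)

lemmas frag_mult_diff = frag_mult_diff_left frag_mult_diff_right

lemma frag_mult_add_left: "frag_mult M (c + c') d = frag_mult M c d + frag_mult M c' d"
  using frag_mult_diff_left[of M c "- c'" d] frag_mult_diff_left[of M 0 c' d] by simp

lemma keys_diff_subset:
  "Poly_Mapping.keys c \<subseteq> S \<Longrightarrow> Poly_Mapping.keys d \<subseteq> S \<Longrightarrow> Poly_Mapping.keys (c - d :: 'a \<Rightarrow>\<^sub>0 int) \<subseteq> S"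
  by (meson Un_least keys_diff order_trans)

lemma keys_add_subset:
  "Poly_Mapping.keys c \<subseteq> S \<Longrightarrow> Poly_Mapping.keys d \<subseteq> S \<Longrightarrow> Poly_Mapping.keys (c + d :: 'a \<Rightarrow>\<^sub>0 int) \<subseteq> S"
  by (meson Un_least Poly_Mapping.keys_add order_trans)

context comm_monoid
begin

lemma keys_frag_mult:
  assumes "Poly_Mapping.keys c \<subseteq> carrier G" "Poly_Mapping.keys d \<subseteq> carrier G"
  shows "Poly_Mapping.keys (frag_mult G c d) \<subseteq> carrier G"
  using assms(1)
proof (induction c rule: frag_induction)
  case (one x)
  note x = this
  show ?case using assms(2)
    by (induction d rule: frag_induction) (simp_all add: x frag_mult_diff keys_diff_subset)
qed (simp_all add: frag_mult_diff keys_diff_subset)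

lemma frag_mult_comm:
  assumes "Poly_Mapping.keys c \<subseteq> carrier G" "Poly_Mapping.keys d \<subseteq> carrier G"
  shows "frag_mult G c d = frag_mult G d c"
  using assms(1)
proof (induction c rule: frag_induction)
  case (one x)
  note x = this
  show ?case using assms(2)
    by (induction d rule: frag_induction) (simp_all add: x frag_mult_diff m_comm)
qed (simp_all add: frag_mult_diff)

lemma frag_mult_assoc:
  assumes "Poly_Mapping.keys c \<subseteq> carrier G" "Poly_Mapping.keys d \<subseteq> carrier G" "Poly_Mapping.keys e \<subseteq> carrier G"
  shows "frag_mult G (frag_mult G c d) e = frag_mult G c (frag_mult G d e)"
  using assms(1)
proof (induction c rule: frag_induction)
  case (one x)
  note x = this
  show ?case using assms(2)
  proof (induction d rule: frag_induction)
    case (one y)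
    note y = this
    show ?case using assms(3)
      by (induction e rule: frag_induction) (simp_all add: x y frag_mult_diff m_assoc)
  qed (simp_all add: frag_mult_diff)
qed (simp_all add: frag_mult_diff)

lemma frag_mult_one:
  assumes "Poly_Mapping.keys c \<subseteq> carrier G"
  shows "frag_mult G (frag_of \<one>) c = c"
  using assms by (induction c rule: frag_induction) (simp_all add: frag_mult_diff)

end

lemma int_monoid_ring_simps [simp]:
  "x \<in> carrier (int_monoid_ring M) \<longleftrightarrow> Poly_Mapping.keys x \<subseteq> carrier M"
  "\<one>\<^bsub>int_monoid_ring M\<^esub> = frag_of \<one>\<^bsub>M\<^esub>"
  "\<zero>\<^bsub>int_monoid_ring M\<^esub> = 0"
  "x \<oplus>\<^bsub>int_monoid_ring M\<^esub> y = x + y"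
  "x \<otimes>\<^bsub>int_monoid_ring M\<^esub> y = frag_mult M x y"
  by (simp_all add: int_monoid_ring_def frag_mult_def)

lemma cring_int_monoid_ring:
  assumes "comm_monoid M"
  shows "cring (int_monoid_ring M)"
proof (rule cringI)
  interpret comm_monoid M by fact
  show "abelian_group (int_monoid_ring M)"
  proof (rule abelian_groupI)
    fix x assume "x \<in> carrier (int_monoid_ring M)"
    then show "\<exists>y\<in>carrier (int_monoid_ring M). y \<oplus>\<^bsub>int_monoid_ring M\<^esub> x = \<zero>\<^bsub>int_monoid_ring M\<^esub>"
      by (intro bexI[of _ "- x"]) simp_all
  qed (simp_all add: keys_add_subset add.assoc add.commute)
  show "comm_monoid (int_monoid_ring M)"
  proof (rule comm_monoidI)
    fix x y assume "x \<in> carrier (int_monoid_ring M)" "y \<in> carrier (int_monoid_ring M)"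
    then show "x \<otimes>\<^bsub>int_monoid_ring M\<^esub> y = y \<otimes>\<^bsub>int_monoid_ring M\<^esub> x"
      by (simp add: frag_mult_comm)
  qed (simp_all add: keys_frag_mult frag_mult_assoc frag_mult_one)
qed (simp add: frag_mult_add_left)

lemma int_monoid_ring_minus:
  assumes "comm_monoid M" "x \<in> carrier (int_monoid_ring M)" "y \<in> carrier (int_monoid_ring M)"
  shows "x \<ominus>\<^bsub>int_monoid_ring M\<^esub> y = x - y"
proof -
  interpret cring "int_monoid_ring M" by (rule cring_int_monoid_ring) fact
  have "\<ominus>\<^bsub>int_monoid_ring M\<^esub> y = - y"
    using assms(3) by (intro minus_equality) simp_all
  then show ?thesis by (simp add: a_minus_def)
qed

section \<open>Homomorphisms out of monoid rings and quotients\<close>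

definition frag_lift :: "('m \<Rightarrow> 'b) \<Rightarrow> ('m \<Rightarrow>\<^sub>0 int) \<Rightarrow> 'b::comm_ring_1"
  where "frag_lift \<eta> c = (\<Sum>p\<in>Poly_Mapping.keys c. of_int (Poly_Mapping.lookup c p) * \<eta> p)"

lemma frag_lift_superset:
  assumes "finite S" "Poly_Mapping.keys c \<subseteq> S"
  shows "frag_lift \<eta> c = (\<Sum>p\<in>S. of_int (Poly_Mapping.lookup c p) * \<eta> p)"
  unfolding frag_lift_def using assms by (intro sum.mono_neutral_left) (auto simp: in_keys_iff)

lemma frag_lift_zero [simp]: "frag_lift \<eta> 0 = 0"
  by (simp add: frag_lift_def)

lemma frag_lift_of [simp]: "frag_lift \<eta> (frag_of x) = \<eta> x"
  by (simp add: frag_lift_def)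

lemma frag_lift_diff: "frag_lift \<eta> (c - d) = frag_lift \<eta> c - frag_lift \<eta> d"
proof -
  let ?S = "Poly_Mapping.keys c \<union> Poly_Mapping.keys d"
  have "frag_lift \<eta> x = (\<Sum>p\<in>?S. of_int (Poly_Mapping.lookup x p) * \<eta> p)" if "x \<in> {c - d, c, d}" for x
    using that keys_diff[of c d] by (intro frag_lift_superset) auto
  then show ?thesis
    by (simp add: lookup_minus left_diff_distrib sum_subtractf)
qed

lemma frag_lift_add: "frag_lift \<eta> (c + d) = frag_lift \<eta> c + frag_lift \<eta> d"
  using frag_lift_diff[of \<eta> c "- d"] frag_lift_diff[of \<eta> 0 d] by simp

lemma frag_lift_mult:
  assumes \<eta>: "\<And>x y. x \<in> carrier M \<Longrightarrow> y \<in> carrier M \<Longrightarrow> \<eta> (x \<otimes>\<^bsub>M\<^esub> y) = \<eta> x * \<eta> y"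
    and "Poly_Mapping.keys c \<subseteq> carrier M" "Poly_Mapping.keys d \<subseteq> carrier M"
  shows "frag_lift \<eta> (frag_mult M c d) = frag_lift \<eta> c * frag_lift \<eta> d"
  using assms(2)
proof (induction c rule: frag_induction)
  case (one x)
  note x = this
  show ?case using assms(3)
    by (induction d rule: frag_induction) (simp_all add: x \<eta> frag_mult_diff frag_lift_diff algebra_simps)
qed (simp_all add: frag_mult_diff frag_lift_diff algebra_simps)

text \<open>Universal property of the quotient ring: \<open>h\<close> is constant on each coset of
  \<open>J\<close>, so the image of a coset is a singleton, and \<open>H\<close> returns its
  element.\<close>

lemma FactRing_lift:
  assumes "cring R" "ideal J R" "h \<in> ring_hom R S" "ring S" "\<And>x. x \<in> J \<Longrightarrow> h x = \<zero>\<^bsub>S\<^esub>"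
  obtains H where "H \<in> ring_hom (R Quot J) S" "\<And>x. x \<in> carrier R \<Longrightarrow> H (J +>\<^bsub>R\<^esub> x) = h x"
proof -
  interpret R: cring R by fact
  interpret J: ideal J R by fact
  interpret S: ring S by fact
  interpret h: ring_hom_ring R S h
    using assms(3) by (intro ring_hom_ringI2) (auto intro: R.ring_axioms S.ring_axioms)
  define H where "H X = the_elem (h ` X)" for X
  have H: "H (J +>\<^bsub>R\<^esub> x) = h x" if x: "x \<in> carrier R" for x
  proof -
    have "h ` (J +>\<^bsub>R\<^esub> x) = {h x}"
    proof
      show "h ` (J +>\<^bsub>R\<^esub> x) \<subseteq> {h x}"
        using x J.Icarr assms(5) by (auto simp: a_r_coset_def')
      show "{h x} \<subseteq> h ` (J +>\<^bsub>R\<^esub> x)"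
        using J.a_rcos_self[OF x] by auto
    qed
    then show ?thesis by (simp add: H_def)
  qed
  interpret q: ring_hom_ring R "R Quot J" "(+>\<^bsub>R\<^esub>) J" by (rule J.rcos_ring_hom_ring)
  have ex: "\<exists>x\<in>carrier R. X = J +>\<^bsub>R\<^esub> x" if "X \<in> carrier (R Quot J)" for X
    using that unfolding FactRing_def A_RCOSETS_def' partial_object.simps by blast
  have "H \<in> ring_hom (R Quot J) S"
  proof (rule ring_hom_memI)
    fix X Y assume XY: "X \<in> carrier (R Quot J)" "Y \<in> carrier (R Quot J)"
    obtain x y where xy: "x \<in> carrier R" "X = J +>\<^bsub>R\<^esub> x" "y \<in> carrier R" "Y = J +>\<^bsub>R\<^esub> y"
      using ex XY by blast
    show "H X \<in> carrier S" using xy H by simp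
    have e: "X \<otimes>\<^bsub>R Quot J\<^esub> Y = J +>\<^bsub>R\<^esub> (x \<otimes>\<^bsub>R\<^esub> y)" "X \<oplus>\<^bsub>R Quot J\<^esub> Y = J +>\<^bsub>R\<^esub> (x \<oplus>\<^bsub>R\<^esub> y)"
      using xy by simp_all
    show "H (X \<otimes>\<^bsub>R Quot J\<^esub> Y) = H X \<otimes>\<^bsub>S\<^esub> H Y" "H (X \<oplus>\<^bsub>R Quot J\<^esub> Y) = H X \<oplus>\<^bsub>S\<^esub> H Y"
      unfolding e unfolding xy(2,4) using xy(1,3)
      by (simp_all add: H del: q.hom_mult q.hom_add)
  next
    show "H \<one>\<^bsub>R Quot J\<^esub> = \<one>\<^bsub>S\<^esub>"
      using H[of "\<one>\<^bsub>R\<^esub>"] by (simp flip: q.hom_one)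
  qed
  then show thesis using H that by blast
qed

section \<open>The tensor product of two algebras\<close>

locale tensor_setting =
  A: cring A + B: cring B + R: cring R
  for R :: "('r, 'l) ring_scheme" and A :: "('a, 'm) ring_scheme" and B :: "('b, 'n) ring_scheme" +
  fixes \<phi> \<psi>
  assumes \<phi>: "r \<in> carrier R \<Longrightarrow> \<phi> r \<in> carrier A"
    and \<psi>: "r \<in> carrier R \<Longrightarrow> \<psi> r \<in> carrier B"
begin

abbreviation "T0 \<equiv> int_monoid_ring (A \<times>\<times> B)"
abbreviation "J \<equiv> Idl\<^bsub>T0\<^esub> (tensor_relations R A B \<phi> \<psi>)"
abbreviation "T \<equiv> tensor_algebra R A B \<phi> \<psi>"

lemma comm_monoid_AB: "comm_monoid (A \<times>\<times> B)"
  by (rule comm_monoidI) (auto simp: A.m_assoc B.m_assoc intro: A.m_comm B.m_comm)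

sublocale T0: cring T0
  by (rule cring_int_monoid_ring[OF comm_monoid_AB])

lemma relations_carrier: "tensor_relations R A B \<phi> \<psi> \<subseteq> carrier T0"
  unfolding tensor_relations_def
  by (auto simp: \<phi> \<psi> intro!: keys_diff_subset dest!: subsetD[OF keys_diff])

sublocale J: ideal J T0
  by (rule T0.genideal_ideal[OF relations_carrier])

lemma T_def': "T = T0 Quot J"
  by (simp add: tensor_algebra_def)

sublocale q: ring_hom_ring T0 T "(+>\<^bsub>T0\<^esub>) J"
  unfolding T_def' by (rule J.rcos_ring_hom_ring)

lemma cring_T: "cring T"
  unfolding T_def' by (rule J.quotient_is_cring[OF T0.is_cring])

text \<open>The map sending \<open>x\<close> to the pure tensor of \<open>x\<close> and 1. It is
  surjective if \<open>\<psi>\<close> is, which reduces questions about \<open>T\<close> to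
  \<open>A\<close>.\<close>

definition left :: "'a \<Rightarrow> _" where "left x = J +>\<^bsub>T0\<^esub> frag_of (x, \<one>\<^bsub>B\<^esub>)"

lemma coset_eqI:
  assumes "c \<in> carrier T0" "d \<in> carrier T0" "c - d \<in> J"
  shows "J +>\<^bsub>T0\<^esub> c = J +>\<^bsub>T0\<^esub> d"
  using T0.quotient_eq_iff_same_a_r_cos[OF J.is_ideal assms(1,2)] assms
  by (simp add: int_monoid_ring_minus[OF comm_monoid_AB assms(1,2)])

lemma relation_in_J: "x \<in> tensor_relations R A B \<phi> \<psi> \<Longrightarrow> x \<in> J"
  using T0.genideal_self[OF relations_carrier] by blast

lemma rel_add_left:
  assumes "x \<in> carrier A" "x' \<in> carrier A" "b \<in> carrier B"
  shows "frag_of (x \<oplus>\<^bsub>A\<^esub> x', b) - frag_of (x, b) - frag_of (x', b) \<in> J"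
  by (rule relation_in_J) (use assms in \<open>auto simp: tensor_relations_def\<close>)

lemma rel_add_right:
  assumes "x \<in> carrier A" "b \<in> carrier B" "b' \<in> carrier B"
  shows "frag_of (x, b \<oplus>\<^bsub>B\<^esub> b') - frag_of (x, b) - frag_of (x, b') \<in> J"
  by (rule relation_in_J) (use assms in \<open>auto simp: tensor_relations_def\<close>)

lemma rel_scalar:
  assumes "r \<in> carrier R" "x \<in> carrier A" "b \<in> carrier B"
  shows "frag_of (\<phi> r \<otimes>\<^bsub>A\<^esub> x, b) - frag_of (x, \<psi> r \<otimes>\<^bsub>B\<^esub> b) \<in> J"
  by (rule relation_in_J) (use assms in \<open>auto simp: tensor_relations_def\<close>)

lemma left_hom: "ring_hom_ring A T left"
proof (rule ring_hom_ringI2[OF A.ring_axioms q.S.ring_axioms], rule ring_hom_memI)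
  fix x y assume xy: "x \<in> carrier A" "y \<in> carrier A"
  have fr: "frag_of (x, \<one>\<^bsub>B\<^esub>) \<in> carrier T0" "frag_of (y, \<one>\<^bsub>B\<^esub>) \<in> carrier T0"
    using xy by simp_all
  show "left x \<in> carrier T"
    unfolding left_def by (rule q.hom_closed[OF fr(1)])
  show "left (x \<otimes>\<^bsub>A\<^esub> y) = left x \<otimes>\<^bsub>T\<^esub> left y"
    unfolding left_def q.hom_mult[OF fr, symmetric] using xy by simp
  have "J +>\<^bsub>T0\<^esub> frag_of (x \<oplus>\<^bsub>A\<^esub> y, \<one>\<^bsub>B\<^esub>) = J +>\<^bsub>T0\<^esub> (frag_of (x, \<one>\<^bsub>B\<^esub>) + frag_of (y, \<one>\<^bsub>B\<^esub>))"
    using xy rel_add_left[of x y "\<one>\<^bsub>B\<^esub>"]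
    by (intro coset_eqI) (auto simp: diff_diff_eq intro!: keys_add_subset dest!: subsetD[OF Poly_Mapping.keys_add])
  then show "left (x \<oplus>\<^bsub>A\<^esub> y) = left x \<oplus>\<^bsub>T\<^esub> left y"
    unfolding left_def q.hom_add[OF fr, symmetric] by simp
next
  show "left \<one>\<^bsub>A\<^esub> = \<one>\<^bsub>T\<^esub>"
    unfolding left_def using q.hom_one by simp
qed

text \<open>Moving \<open>r\<close> across the tensor sign turns the generator
  \<open>(x, \<psi> r)\<close> into one with second entry 1, and the image of \<open>left\<close> is
  closed under differences.\<close>

lemma left_surj:
  assumes surj: "\<And>b. b \<in> carrier B \<Longrightarrow> \<exists>r\<in>carrier R. b = \<psi> r"
    and X: "X \<in> carrier T"
  shows "\<exists>x\<in>carrier A. X = left x"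
proof -
  interpret l: ring_hom_ring A T left by (rule left_hom)
  obtain c where c: "c \<in> carrier T0" "X = J +>\<^bsub>T0\<^esub> c"
    using X unfolding T_def' FactRing_def A_RCOSETS_def' partial_object.simps by blast
  from c(1) have "Poly_Mapping.keys c \<subseteq> carrier A \<times> carrier B" by simp
  \<comment> \<open>The support condition is carried along so that both parts of a difference are
    known to lie in \<open>T0\<close>.\<close>
  then have "Poly_Mapping.keys c \<subseteq> carrier A \<times> carrier B \<and> (\<exists>x\<in>carrier A. J +>\<^bsub>T0\<^esub> c = left x)"
  proof (induction c rule: frag_induction)
    case zero
    have "J +>\<^bsub>T0\<^esub> 0 = left \<zero>\<^bsub>A\<^esub>"
      using q.hom_zero l.hom_zero by simp
    then show ?case
      by (metis A.zero_closed empty_subsetI keys_zero)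
  next
    case (one p)
    then obtain x r where p: "p = (x, \<psi> r)" "x \<in> carrier A" "r \<in> carrier R"
      using surj by (metis SigmaE)
    have "J +>\<^bsub>T0\<^esub> frag_of (\<phi> r \<otimes>\<^bsub>A\<^esub> x, \<one>\<^bsub>B\<^esub>) = J +>\<^bsub>T0\<^esub> frag_of p"
      using p rel_scalar[of r x "\<one>\<^bsub>B\<^esub>"] by (intro coset_eqI) (simp_all add: \<phi> \<psi>)
    then show ?case
      using p one by (auto simp: left_def \<phi> intro!: bexI[of _ "\<phi> r \<otimes>\<^bsub>A\<^esub> x"])
  next
    case (diff c d)
    then obtain x y where xy: "x \<in> carrier A" "J +>\<^bsub>T0\<^esub> c = left x" "y \<in> carrier A" "J +>\<^bsub>T0\<^esub> d = left y"
      by blast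
    have cd: "c \<in> carrier T0" "d \<in> carrier T0" using diff by simp_all
    have "J +>\<^bsub>T0\<^esub> (c - d) = J +>\<^bsub>T0\<^esub> (c \<ominus>\<^bsub>T0\<^esub> d)"
      by (simp add: int_monoid_ring_minus[OF comm_monoid_AB cd])
    also have "\<dots> = left (x \<ominus>\<^bsub>A\<^esub> y)"
      unfolding a_minus_def using cd xy by (simp del: int_monoid_ring_simps)
    finally show ?case
      using diff xy by (auto intro: keys_diff_subset dest!: subsetD[OF keys_diff])
  qed
  then show ?thesis using c by auto
qed

text \<open>The scalar moves to the second factor, where it becomes 0, and a pure tensor with second
  factor 0 vanishes.\<close>

lemma left_kernel:
  assumes r: "r \<in> carrier R" "\<psi> r = \<zero>\<^bsub>B\<^esub>" and x: "x \<in> carrier A"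
  shows "left (\<phi> r \<otimes>\<^bsub>A\<^esub> x) = \<zero>\<^bsub>T\<^esub>"
proof -
  have "J +>\<^bsub>T0\<^esub> frag_of (\<phi> r \<otimes>\<^bsub>A\<^esub> x, \<one>\<^bsub>B\<^esub>) = J +>\<^bsub>T0\<^esub> frag_of (x, \<zero>\<^bsub>B\<^esub>)"
    using r x rel_scalar[of r x "\<one>\<^bsub>B\<^esub>"] by (intro coset_eqI) (simp_all add: \<phi>)
  also have "\<dots> = J +>\<^bsub>T0\<^esub> \<zero>\<^bsub>T0\<^esub>"
  proof -
    \<comment> \<open>Additivity for \<open>0 + 0 = 0\<close> leaves a single negated
      generator.\<close>
    have "0 - frag_of (x, \<zero>\<^bsub>B\<^esub>) \<in> J"
      using x rel_add_right[of x "\<zero>\<^bsub>B\<^esub>" "\<zero>\<^bsub>B\<^esub>"] by simp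
    then show ?thesis
      using x by (intro coset_eqI[symmetric]) simp_all
  qed
  finally show ?thesis
    unfolding left_def by (simp only: q.hom_zero)
qed

text \<open>Universal property of the tensor product: a multiplicative, biadditive and balanced
  \<open>\<eta>\<close> sends the three kinds of relations to 0, so its additive extension descends
  to \<open>T\<close>.\<close>

lemma tensor_lift:
  fixes \<eta> :: "'a \<times> 'b \<Rightarrow> (('v::finite \<Rightarrow>\<^sub>0 nat) \<Rightarrow>\<^sub>0 'k::field)"
  assumes mult: "\<And>x y b c. x \<in> carrier A \<Longrightarrow> y \<in> carrier A \<Longrightarrow> b \<in> carrier B \<Longrightarrow> c \<in> carrier B
      \<Longrightarrow> \<eta> (x \<otimes>\<^bsub>A\<^esub> y, b \<otimes>\<^bsub>B\<^esub> c) = \<eta> (x, b) * \<eta> (y, c)"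
    and one: "\<eta> (\<one>\<^bsub>A\<^esub>, \<one>\<^bsub>B\<^esub>) = 1"
    and addl: "\<And>x y b. x \<in> carrier A \<Longrightarrow> y \<in> carrier A \<Longrightarrow> b \<in> carrier B
      \<Longrightarrow> \<eta> (x \<oplus>\<^bsub>A\<^esub> y, b) = \<eta> (x, b) + \<eta> (y, b)"
    and addr: "\<And>x b c. x \<in> carrier A \<Longrightarrow> b \<in> carrier B \<Longrightarrow> c \<in> carrier B
      \<Longrightarrow> \<eta> (x, b \<oplus>\<^bsub>B\<^esub> c) = \<eta> (x, b) + \<eta> (x, c)"
    and scal: "\<And>r x b. r \<in> carrier R \<Longrightarrow> x \<in> carrier A \<Longrightarrow> b \<in> carrier B
      \<Longrightarrow> \<eta> (\<phi> r \<otimes>\<^bsub>A\<^esub> x, b) = \<eta> (x, \<psi> r \<otimes>\<^bsub>B\<^esub> b)"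
  obtains H where "ring_hom_ring T mpoly_ring H" "\<And>x. x \<in> carrier A \<Longrightarrow> H (left x) = \<eta> (x, \<one>\<^bsub>B\<^esub>)"
proof -
  interpret S: cring "mpoly_ring :: (('v \<Rightarrow>\<^sub>0 nat) \<Rightarrow>\<^sub>0 'k) ring" by (rule cring_mpoly_ring)
  have h: "frag_lift \<eta> \<in> ring_hom T0 mpoly_ring"
    by (rule ring_hom_memI) (auto simp: frag_lift_add one intro!: frag_lift_mult mult)
  interpret h: ring_hom_ring T0 "mpoly_ring :: (('v \<Rightarrow>\<^sub>0 nat) \<Rightarrow>\<^sub>0 'k) ring" "frag_lift \<eta>"
    by (rule ring_hom_ringI2[OF T0.ring_axioms S.ring_axioms h])
  have "tensor_relations R A B \<phi> \<psi> \<subseteq> a_kernel T0 mpoly_ring (frag_lift \<eta>)"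
  proof
    fix x assume x: "x \<in> tensor_relations R A B \<phi> \<psi>"
    then have "frag_lift \<eta> x = 0"
      unfolding tensor_relations_def by (auto simp: frag_lift_diff addl addr scal)
    then show "x \<in> a_kernel T0 mpoly_ring (frag_lift \<eta>)"
      using x relations_carrier unfolding a_kernel_def' by (auto simp del: int_monoid_ring_simps)
  qed
  then have "J \<subseteq> a_kernel T0 mpoly_ring (frag_lift \<eta>)"
    by (intro T0.genideal_minimal h.kernel_is_ideal)
  then have 0: "frag_lift \<eta> x = \<zero>\<^bsub>mpoly_ring\<^esub>" if "x \<in> J" for x
    using that unfolding a_kernel_def' by auto
  obtain H where H: "H \<in> ring_hom (T0 Quot J) mpoly_ring"
      "\<And>x. x \<in> carrier T0 \<Longrightarrow> H (J +>\<^bsub>T0\<^esub> x) = frag_lift \<eta> x"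
    using FactRing_lift[OF T0.is_cring J.is_ideal h S.ring_axioms 0] by blast
  have "ring_hom_ring T mpoly_ring H"
    using H(1) unfolding T_def'[symmetric] by (intro ring_hom_ringI2 q.S.ring_axioms S.ring_axioms)
  moreover have "H (left x) = \<eta> (x, \<one>\<^bsub>B\<^esub>)" if "x \<in> carrier A" for x
    unfolding left_def using that by (subst H(2)) simp_all
  ultimately show thesis using that by blast
qed

end

subsection \<open>Chains of primes and algebraic dependence\<close>

text \<open>There are more unknowns than homogeneous linear equations. By Gaussian elimination, an
  equation in which some unknown occurs is solved for it, and the induction hypothesis applies to
  the others.\<close>

lemma exists_linear_dependence:
  fixes M :: "'a \<Rightarrow> 'b \<Rightarrow> 'k::field"
  assumes "finite B" "finite A" "card B < card A"
  shows "\<exists>c. (\<exists>a\<in>A. c a \<noteq> 0) \<and> (\<forall>b\<in>B. (\<Sum>a\<in>A. c a * M a b) = 0)"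
  using assms
proof (induction B arbitrary: A M rule: finite_induct)
  case empty
  then obtain a where "a \<in> A" by (metis card.empty ex_in_conv less_irrefl)
  then show ?case by (intro exI[of _ "\<lambda>_. 1"]) auto
next
  case (insert b B)
  show ?case
  proof (cases "\<forall>a\<in>A. M a b = 0")
    case True
    have "card B < card A" using insert by simp
    from insert.IH[OF insert.prems(1) this, of M] show ?thesis
      using True by auto
  next
    case False
    then obtain p where p: "p \<in> A" "M p b \<noteq> 0" by blast
    let ?A = "A - {p}"
    \<comment> \<open>The system left after eliminating the unknown \<open>p\<close> by means of
      equation \<open>b\<close>.\<close>
    define M' where "M' a b' = M a b' - M a b / M p b * M p b'" for a b'
    have "card B < card ?A" using insert p by simp
    with insert.IH[of ?A M'] insert.prems(1) obtain c where
      c: "\<exists>a\<in>?A. c a \<noteq> 0" "\<And>b'. b' \<in> B \<Longrightarrow> (\<Sum>a\<in>?A. c a * M' a b') = 0" by auto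
    define s where "s = (\<Sum>a\<in>?A. c a * M a b)"
    \<comment> \<open>The value at \<open>p\<close> is forced by equation \<open>b\<close>.\<close>
    define d where "d a = (if a = p then - s / M p b else c a)" for a
    have sum_d: "(\<Sum>a\<in>A. d a * M a b') = - s / M p b * M p b' + (\<Sum>a\<in>?A. c a * M a b')" for b'
    proof -
      have "(\<Sum>a\<in>?A. d a * M a b') = (\<Sum>a\<in>?A. c a * M a b')"
        by (rule sum.cong) (auto simp: d_def)
      then show ?thesis
        using insert.prems(1) p(1) by (subst sum.remove[of _ p]) (simp_all add: d_def)
    qed
    have "(\<Sum>a\<in>A. d a * M a b') = 0" if "b' \<in> insert b B" for b'
    proof (cases "b' = b")
      case True
      then show ?thesis using p(2) by (simp add: sum_d s_def)
    next
      case False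
      have "(\<Sum>a\<in>?A. c a * M' a b') = (\<Sum>a\<in>?A. c a * M a b' - c a * M a b * (M p b' / M p b))"
        by (rule sum.cong) (simp_all add: M'_def algebra_simps)
      also have "\<dots> = (\<Sum>a\<in>?A. c a * M a b') - s * (M p b' / M p b)"
        unfolding s_def sum_subtractf sum_distrib_right ..
      finally have "(\<Sum>a\<in>?A. c a * M a b') = s * (M p b' / M p b)"
        using c(2)[of b'] that False by simp
      then show ?thesis by (simp add: sum_d)
    qed
    moreover have "\<exists>a\<in>A. d a \<noteq> 0"
      using c(1) by (auto simp: d_def)
    ultimately show ?thesis by blast
  qed
qed

section \<open>Primes in subrings and independence of power products\<close>

definition subring_of :: "'r::comm_ring_1 set \<Rightarrow> bool"
  where "subring_of S \<longleftrightarrow> 1 \<in> S \<and> (\<forall>x\<in>S. \<forall>y\<in>S. x + y \<in> S) \<and> (\<forall>x\<in>S. - x \<in> S) \<and> (\<forall>x\<in>S. \<forall>y\<in>S. x * y \<in> S)"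

lemma subring_ofD:
  assumes "subring_of S"
  shows "1 \<in> S" "0 \<in> S" "x \<in> S \<Longrightarrow> y \<in> S \<Longrightarrow> x + y \<in> S" "x \<in> S \<Longrightarrow> - x \<in> S"
    "x \<in> S \<Longrightarrow> y \<in> S \<Longrightarrow> x * y \<in> S" "x \<in> S \<Longrightarrow> x ^ n \<in> S"
proof -
  show *: "1 \<in> S" "x \<in> S \<Longrightarrow> y \<in> S \<Longrightarrow> x + y \<in> S" "x \<in> S \<Longrightarrow> - x \<in> S"
    "x \<in> S \<Longrightarrow> y \<in> S \<Longrightarrow> x * y \<in> S" for x y
    using assms by (auto simp: subring_of_def)
  have "1 + (- 1) \<in> S" by (intro *)
  then show "0 \<in> S" by simp
  show "x \<in> S \<Longrightarrow> x ^ n \<in> S"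
    by (induction n) (use * in auto)
qed

lemma subring_of_sum:
  "subring_of S \<Longrightarrow> (\<And>i. i \<in> A \<Longrightarrow> f i \<in> S) \<Longrightarrow> (\<Sum>i\<in>A. f i) \<in> S"
  by (induction A rule: infinite_finite_induct) (auto intro: subring_ofD)

text \<open>A prime ideal of the subring \<open>S\<close>, stated inside a ring type so that the
  usual sums and powers are available.\<close>

definition prime_in :: "'r::comm_ring_1 set \<Rightarrow> 'r set \<Rightarrow> bool"
  where "prime_in S P \<longleftrightarrow> P \<subseteq> S \<and> 0 \<in> P \<and> (\<forall>x\<in>P. \<forall>y\<in>P. x + y \<in> P) \<and> (\<forall>x\<in>S. \<forall>y\<in>P. x * y \<in> P) \<and>
    (\<forall>x\<in>S. \<forall>y\<in>S. x * y \<in> P \<longrightarrow> x \<in> P \<or> y \<in> P) \<and> 1 \<notin> P"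

lemma prime_inD:
  assumes "prime_in S P"
  shows "x \<in> P \<Longrightarrow> x \<in> S" "0 \<in> P" "x \<in> P \<Longrightarrow> y \<in> P \<Longrightarrow> x + y \<in> P" "x \<in> S \<Longrightarrow> y \<in> P \<Longrightarrow> x * y \<in> P"
    "x \<in> S \<Longrightarrow> y \<in> S \<Longrightarrow> x * y \<in> P \<Longrightarrow> x \<in> P \<or> y \<in> P" "1 \<notin> P"
  using assms by (auto simp: prime_in_def)

lemma prime_in_power:
  assumes "subring_of S" "prime_in S P" "x \<in> S" "x ^ n \<in> P"
  shows "x \<in> P"
  using assms(4)
proof (induction n)
  case 0
  then show ?case using prime_inD(6)[OF assms(2)] by simp
next
  case (Suc n)
  then show ?case
    using prime_inD(5)[OF assms(2,3) subring_ofD(6)[OF assms(1,3)]] by auto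
qed

definition mono_prod :: "'r::comm_ring_1 list \<Rightarrow> nat list \<Rightarrow> 'r"
  where "mono_prod fs e = prod_list (map2 (^) fs e)"

lemma mono_prod_Nil [simp]: "mono_prod [] e = 1"
  by (simp add: mono_prod_def)

lemma mono_prod_Cons [simp]: "mono_prod (f # fs) (m # e) = f ^ m * mono_prod fs e"
  by (simp add: mono_prod_def)

lemma mono_prod_closed:
  assumes "subring_of S"
  shows "set fs \<subseteq> S \<Longrightarrow> mono_prod fs e \<in> S"
proof (induction fs arbitrary: e)
  case (Cons f fs)
  then show ?case
    by (cases e) (auto simp: mono_prod_def[of _ "[]"] intro!: subring_ofD[OF assms])
qed (simp add: subring_ofD[OF assms])

text \<open>
  Compare the exponents lexicographically: dividing by the smallest power of the first
  element, which is a nonmember of the first prime, and passing to the second prime, which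
  contains that element, discards all other exponents of it.
\<close>

lemma prime_chain_independent:
  assumes S: "subring_of S"
    and "\<And>i. i \<le> length fs \<Longrightarrow> prime_in S (P i)"
    and "\<And>i. i < length fs \<Longrightarrow> P i \<subseteq> P (Suc i)"
    and "\<And>i. i < length fs \<Longrightarrow> fs ! i \<in> P (Suc i) - P i"
    and "finite E" "E \<noteq> {}" "\<And>e. e \<in> E \<Longrightarrow> length e = length fs"
    and "\<And>e. e \<in> E \<Longrightarrow> c e \<in> S"
    and "\<And>e i. e \<in> E \<Longrightarrow> i \<le> length fs \<Longrightarrow> c e \<notin> P i"
  shows "(\<Sum>e\<in>E. c e * mono_prod fs e) \<notin> P 0"
  using assms(2-)
proof (induction fs arbitrary: P E c)
  case Nil
  then have "E = {[]}" by auto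
  then show ?case using Nil(8)[of "[]" 0] by simp
next
  case (Cons f fs)
  note P = Cons.prems(1) and P_sub = Cons.prems(2) and fs = Cons.prems(3)
  have f: "f \<in> P 1" "f \<notin> P 0" using fs[of 0] by auto
  have P0: "prime_in S (P 0)" and P1: "prime_in S (P 1)" using P[of 0] P[of 1] by auto
  have fS: "f \<in> S" using prime_inD(1)[OF P1] f by blast
  have "set (f # fs) \<subseteq> S"
  proof
    fix x assume "x \<in> set (f # fs)"
    then obtain i where "i < length (f # fs)" "x = (f # fs) ! i" by (metis in_set_conv_nth)
    then show "x \<in> S" using fs[of i] prime_inD(1)[OF P[of "Suc i"]] by auto
  qed
  then have mS: "mono_prod fs e \<in> S" for e using mono_prod_closed[OF S, of fs e] by simp
  define m where "m = Min (hd ` E)"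
  have m_le: "m \<le> hd e" if "e \<in> E" for e unfolding m_def using Cons.prems(4) that by simp
  define E1 where "E1 = {e \<in> E. hd e = m}"
  define E2 where "E2 = {e \<in> E. hd e \<noteq> m}"
  have E: "E = E1 \<union> E2" "E1 \<inter> E2 = {}" "finite E1" "finite E2"
    using Cons.prems(4) by (auto simp: E1_def E2_def)
  have split: "e = hd e # tl e" if "e \<in> E" for e
    using Cons.prems(6)[OF that] by (cases e) auto
  have "m \<in> hd ` E" unfolding m_def using Cons.prems(4,5) by (intro Min_in) auto
  then have E1_ne: "E1 \<noteq> {}" by (auto simp: E1_def)
  define s1 where "s1 = (\<Sum>e\<in>E1. c e * mono_prod fs (tl e))"
  \<comment> \<open>All first exponents in \<open>E2\<close> exceed \<open>m\<close>, so one further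
    factor \<open>f\<close> can be taken out and the subtraction is exact.\<close>
  define s2 where "s2 = (\<Sum>e\<in>E2. c e * (f ^ (hd e - Suc m) * mono_prod fs (tl e)))"
  have cS: "c e \<in> S" if "e \<in> E" for e using Cons.prems(7) that by blast
  have s1S: "s1 \<in> S"
    unfolding s1_def using E(1) by (intro subring_of_sum[OF S] subring_ofD(5)[OF S] cS mS) auto
  have s2S: "s2 \<in> S"
    unfolding s2_def using E(1)
    by (intro subring_of_sum[OF S] subring_ofD(5)[OF S] subring_ofD(6)[OF S] cS mS fS) auto
  have "(\<Sum>e\<in>E1. c e * mono_prod (f # fs) e) = f ^ m * s1"
    unfolding s1_def sum_distrib_left
  proof (rule sum.cong)
    fix e assume "e \<in> E1"
    then have "e = m # tl e" using split[of e] by (simp add: E1_def)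
    then have "mono_prod (f # fs) e = f ^ m * mono_prod fs (tl e)"
      using mono_prod_Cons by metis
    then show "c e * mono_prod (f # fs) e = f ^ m * (c e * mono_prod fs (tl e))"
      by (simp add: algebra_simps)
  qed simp
  moreover have "(\<Sum>e\<in>E2. c e * mono_prod (f # fs) e) = f ^ m * (f * s2)"
    unfolding s2_def sum_distrib_left
  proof (rule sum.cong)
    fix e assume e: "e \<in> E2"
    then have "hd e = m + (1 + (hd e - Suc m))" using m_le[of e] by (simp add: E2_def)
    moreover have "e = hd e # tl e" using e split by (simp add: E2_def)
    ultimately have "mono_prod (f # fs) e = f ^ (m + (1 + (hd e - Suc m))) * mono_prod fs (tl e)"
      using mono_prod_Cons by metis
    then show "c e * mono_prod (f # fs) e = f ^ m * (f * (c e * (f ^ (hd e - Suc m) * mono_prod fs (tl e))))"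
      by (simp add: power_add algebra_simps)
  qed simp
  ultimately have total: "(\<Sum>e\<in>E. c e * mono_prod (f # fs) e) = f ^ m * (s1 + f * s2)"
    using E by (simp add: sum.union_disjoint distrib_left)
  have E1': "s1 = (\<Sum>e\<in>tl ` E1. c (m # e) * mono_prod fs e)"
  proof -
    have inj: "inj_on tl E1" using split by (auto simp: inj_on_def E1_def) (metis split)
    show ?thesis
      unfolding s1_def sum.reindex[OF inj] o_def
    proof (rule sum.cong)
      fix e assume "e \<in> E1"
      then have "e = m # tl e" using split[of e] by (simp add: E1_def)
      then show "c e * mono_prod fs (tl e) = c (m # tl e) * mono_prod fs (tl e)" by simp
    qed simp
  qed
  have cons: "m # e \<in> E" if "e \<in> tl ` E1" for e
    using that split by (auto simp: E1_def)
  \<comment> \<open>The induction hypothesis is used for the chain that starts at the second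
    prime.\<close>
  have "s1 \<notin> P (Suc 0)"
    unfolding E1'
  proof (rule Cons.IH)
    fix i assume "i < length fs"
    then show "fs ! i \<in> P (Suc (Suc i)) - P (Suc i)" using fs[of "Suc i"] by simp
  next
    fix e assume "e \<in> tl ` E1"
    then have "m # e \<in> E" by (rule cons)
    then show "length e = length fs" using Cons.prems(6) by fastforce
  qed (use Cons.prems cons E E1_ne in auto)
  \<comment> \<open>The part with larger exponents lies in \<open>P 1\<close> because of its factor
    \<open>f\<close>, so it can be subtracted.\<close>
  moreover have "s1 \<in> P 1" if "s1 + f * s2 \<in> P 1"
  proof -
    have "(- s2) * f \<in> P 1"
      using f(1) s2S by (intro prime_inD(4)[OF P1] subring_ofD(4)[OF S])
    then have "(s1 + f * s2) + (- s2) * f \<in> P 1"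
      by (rule prime_inD(3)[OF P1 that])
    moreover have "(s1 + f * s2) + (- s2) * f = s1" by (simp add: algebra_simps)
    ultimately show ?thesis by metis
  qed
  ultimately have "s1 + f * s2 \<notin> P 0"
    using P_sub[of 0] by auto
  moreover have "f ^ m \<notin> P 0"
    using prime_in_power[OF S P0 fS] f(2) by blast
  ultimately show ?case
    unfolding total
    using prime_inD(5)[OF P0] subring_ofD(6)[OF S fS] subring_ofD(3)[OF S s1S subring_ofD(5)[OF S fS s2S]]
    by blast
qed

subsection \<open>The upper bound\<close>

lemma deg_in_remove: "x \<in> V \<Longrightarrow> deg_in V u = lookup u x + deg_in (V - {x}) (u :: 'v::finite \<Rightarrow>\<^sub>0 nat)"
  unfolding deg_in_def by (subst sum.remove[of V x]) simp_all

lemma deg_in_cong: "(\<And>v. v \<in> V \<Longrightarrow> lookup u v = lookup w v) \<Longrightarrow> deg_in V u = deg_in V w"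
  by (simp add: deg_in_def)

lemma lookup_le_deg_in: "x \<in> V \<Longrightarrow> lookup (u :: 'v::finite \<Rightarrow>\<^sub>0 nat) x \<le> deg_in V u"
  by (simp add: deg_in_remove)

text \<open>A crude bound, factor by factor; it limits the powers of \<open>t\<close> that occur in
  power products with exponents at most \<open>N\<close>.\<close>

lemma degree_mono_prod:
  assumes "length e = length fs" "\<And>f. f \<in> set fs \<Longrightarrow> Polynomial.degree f \<le> D" "set e \<subseteq> {..N}"
  shows "Polynomial.degree (mono_prod fs e) \<le> length fs * (N * D)"
  using assms
proof (induction e fs rule: list_induct2)
  case (Cons m e f fs)
  have "Polynomial.degree (f ^ m) \<le> Polynomial.degree f * m" by (rule degree_power_le)
  also have "\<dots> \<le> N * D" using Cons.prems by (subst mult.commute) (auto intro!: mult_le_mono)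
  finally have "Polynomial.degree (f ^ m) \<le> N * D" .
  moreover have "Polynomial.degree (mono_prod fs e) \<le> length fs * (N * D)"
    using Cons by auto
  ultimately show ?case
    using degree_mult_le[of "f ^ m" "mono_prod fs e"] by simp
qed simp

text \<open>Lets membership in a prime be checked on the single terms of a polynomial.\<close>

lemma poly_mem_by_monomials:
  fixes p :: "(('a \<Rightarrow>\<^sub>0 'b::comm_monoid_add)) poly"
  assumes "0 \<in> P" "\<And>x y. x \<in> P \<Longrightarrow> y \<in> P \<Longrightarrow> x + y \<in> P"
    and "\<And>k u. lookup (Polynomial.coeff p k) u \<noteq> 0 \<Longrightarrow>
      Polynomial.monom (Poly_Mapping.single u (lookup (Polynomial.coeff p k) u)) k \<in> P"
  shows "p \<in> P"
proof -
  have sum: "(\<Sum>i\<in>A. f i) \<in> P" if "\<And>i. i \<in> A \<Longrightarrow> f i \<in> P" for A and f :: "'c \<Rightarrow> _"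
    using that by (induction A rule: infinite_finite_induct) (auto intro: assms)
  have "Polynomial.monom (Polynomial.coeff p k) k \<in> P" for k
  proof -
    have hom: "Polynomial.monom (\<Sum>i\<in>A. f i) k = (\<Sum>i\<in>A. Polynomial.monom (f i) k)"
      for A and f :: "'a \<Rightarrow> ('a \<Rightarrow>\<^sub>0 'b)"
      by (induction A rule: infinite_finite_induct) (simp_all add: add_monom[symmetric])
    have "(\<Sum>u\<in>keys (Polynomial.coeff p k).
        Polynomial.monom (Poly_Mapping.single u (lookup (Polynomial.coeff p k) u)) k) \<in> P"
      by (intro sum assms(3)) (simp add: in_keys_iff)
    then show ?thesis
      unfolding hom[symmetric] poly_mapping_sum_singles[symmetric] .
  qed
  then have "(\<Sum>k\<le>Polynomial.degree p. Polynomial.monom (Polynomial.coeff p k) k) \<in> P"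
    by (intro sum)
  then show ?thesis by (simp add: poly_as_sum_of_monoms)
qed

text \<open>\<open>x0\<close> and \<open>z0\<close> witness that \<open>X\<close> and
  \<open>Z\<close> are nonempty. In the upper bound their coordinates are recovered from degree
  equations; in the lower bound they fill exponents up to the face.\<close>

locale two_primes =
  fixes X Y Z :: "'v::finite set" and a b :: nat and x0 z0 :: 'v
  assumes UNIV: "X \<union> Y \<union> Z = UNIV" and disj: "X \<inter> Y = {}" "X \<inter> Z = {}" "Y \<inter> Z = {}"
    and x0: "x0 \<in> X" and z0: "z0 \<in> Z" and a: "a \<ge> 1" and b: "b \<ge> 1"
begin

abbreviation "U \<equiv> rees_exps (X \<union> Y) (Y \<union> Z) a b"

text \<open>
  Contains every \<open>(u, k)\<close> for which \<open>x\<^sup>u\<close> is a minimal generator of \<open>I\<^sup>k\<close>.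
\<close>

definition reduced :: "(('v \<Rightarrow>\<^sub>0 nat) \<times> nat) set"
  where "reduced =
    {(u, k). deg_in (X \<union> Y) u = a * k \<and> deg_in (Y \<union> Z) u = b * k}
  \<union> {(u, k). deg_in (X \<union> Y) u = a * k \<and> deg_in Z u = 0}
  \<union> {(u, k). deg_in (Y \<union> Z) u = b * k \<and> deg_in X u = 0}"

text \<open>If both bounds are exceeded, any variable of \<open>X \<union> Y\<close> occurring in
  \<open>u\<close> can be taken off; if one is attained, a variable outside the set of that bound
  can. Such monomials lie in the maximal ideal times the \<open>k\<close>-th power and vanish in the
  quotient by the variables.\<close>

lemma not_reduced_split:
  assumes u: "u \<in> U k" and nr: "(u, k) \<notin> reduced"
  shows "\<exists>v w. u = Poly_Mapping.single v 1 + w \<and> w \<in> U k"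
proof -
  have ge: "a * k \<le> deg_in (X \<union> Y) u" "b * k \<le> deg_in (Y \<union> Z) u"
    using u by (auto simp: rees_exps_def)
  consider "a * k < deg_in (X \<union> Y) u" "b * k < deg_in (Y \<union> Z) u"
    | "a * k = deg_in (X \<union> Y) u" "b * k < deg_in (Y \<union> Z) u" "deg_in Z u > 0"
    | "a * k < deg_in (X \<union> Y) u" "b * k = deg_in (Y \<union> Z) u" "deg_in X u > 0"
    using ge nr unfolding reduced_def by fastforce
  then show ?thesis
  proof cases
    case 1
    then have "deg_in (X \<union> Y) u > 0" by simp
    then obtain v w where "v \<in> X \<union> Y" "u = Poly_Mapping.single v 1 + w"
      by (rule deg_in_pos_split)
    with 1 show ?thesis
      by (intro exI[of _ v] exI[of _ w]) (auto simp: rees_exps_def deg_in_add deg_in_single when_def split: if_splits)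
  next
    case 2
    from 2(3) obtain v w where "v \<in> Z" "u = Poly_Mapping.single v 1 + w"
      by (rule deg_in_pos_split)
    with 2 disj show ?thesis
      by (intro exI[of _ v] exI[of _ w]) (auto simp: rees_exps_def deg_in_add deg_in_single when_def split: if_splits)
  next
    case 3
    from 3(3) obtain v w where "v \<in> X" "u = Poly_Mapping.single v 1 + w"
      by (rule deg_in_pos_split)
    with 3 disj show ?thesis
      by (intro exI[of _ v] exI[of _ w]) (auto simp: rees_exps_def deg_in_add deg_in_single when_def split: if_splits)
  qed
qed

text \<open>\<open>F\<close> records one coordinate less than there are variables. It is left open
  what it records, so that \<open>k\<close> can take the place of an entry of the exponent.\<close>

lemma box_bound:
  fixes B :: "'c set" and F :: "'c \<Rightarrow> 'v \<Rightarrow> nat"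
  assumes inj: "inj_on F B" and F: "\<And>u. u \<in> B \<Longrightarrow> F u \<in> (UNIV - {w}) \<rightarrow>\<^sub>E {..M}"
  shows "finite B \<and> card B \<le> (M + 1) ^ (card (UNIV :: 'v set) - 1)"
proof -
  let ?F = "(UNIV - {w :: 'v}) \<rightarrow>\<^sub>E {..M :: nat}"
  have fin: "finite ?F" by (intro finite_PiE) auto
  have sub: "F ` B \<subseteq> ?F" using F by blast
  have "card ?F = (M + 1) ^ (card (UNIV :: 'v set) - 1)"
    by (subst card_PiE) (auto simp: card_Diff_singleton)
  then show ?thesis
    using inj_on_finite[OF inj sub fin] card_inj_on_le[OF inj sub fin] by simp
qed

lemma deg_in_eq_0_iff: "deg_in V (u :: 'v \<Rightarrow>\<^sub>0 nat) = 0 \<longleftrightarrow> (\<forall>v\<in>V. lookup u v = 0)"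
  by (simp add: deg_in_def)

text \<open>The degree in a set containing \<open>w\<close> determines the one coordinate left
  open.\<close>

lemma exp_eqI:
  assumes "\<And>v. v \<noteq> w \<Longrightarrow> lookup u v = lookup u' v" "w \<in> V" "deg_in V u = deg_in V (u' :: 'v \<Rightarrow>\<^sub>0 nat)"
  shows "u = u'"
proof (rule poly_mapping_eqI)
  fix v
  have "deg_in (V - {w}) u = deg_in (V - {w}) u'" using assms(1) by (intro deg_in_cong) auto
  then have "lookup u w = lookup u' w"
    using assms(3) by (simp add: deg_in_remove[OF assms(2)])
  then show "lookup u v = lookup u' v" using assms(1) by (cases "v = w") auto
qed

text \<open>Each of the three families making up \<open>reduced\<close> embeds into a box with one
  coordinate less than there are variables.\<close>

lemma card_reduced:
  fixes L :: nat
  defines "B \<equiv> {(u, k). (u, k) \<in> reduced \<and> k \<le> L}"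
  shows "finite B" "card B \<le> 3 * ((a + b) * L + 1) ^ (card (UNIV :: 'v set) - 1)"
proof -
  let ?M = "(a + b) * L"
  define B1 where "B1 = {(u, k). deg_in (X \<union> Y) u = a * k \<and> deg_in (Y \<union> Z) u = b * k \<and> k \<le> L}"
  define B2 where "B2 = {(u, k). deg_in (X \<union> Y) u = a * k \<and> deg_in Z u = 0 \<and> k \<le> L}"
  define B3 where "B3 = {(u, k). deg_in (Y \<union> Z) u = b * k \<and> deg_in X u = 0 \<and> k \<le> L}"
  have B: "B = B1 \<union> B2 \<union> B3"
    by (auto simp: B_def B1_def B2_def B3_def reduced_def)
  have le: "a * k \<le> ?M" "b * k \<le> ?M" "k \<le> ?M" if "k \<le> L" for k
  proof -
    have "a * k \<le> a * L" "b * k \<le> b * L" "1 * L \<le> a * L" using that a by (auto intro: mult_le_mono)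
    then show "a * k \<le> ?M" "b * k \<le> ?M" "k \<le> ?M" using that unfolding add_mult_distrib by linarith+
  qed
  have leP: "lookup u v \<le> ?M" if "v \<in> X \<union> Y" "deg_in (X \<union> Y) u = a * k" "k \<le> L" for u v k
    using lookup_le_deg_in[OF that(1), of u] le(1)[OF that(3)] that(2) by linarith
  have leQ: "lookup u v \<le> ?M" if "v \<in> Y \<union> Z" "deg_in (Y \<union> Z) u = b * k" "k \<le> L" for u v k
    using lookup_le_deg_in[OF that(1), of u] le(2)[OF that(3)] that(2) by linarith
  have "finite B1 \<and> card B1 \<le> (?M + 1) ^ (card (UNIV :: 'v set) - 1)"
  proof (rule box_bound)
    \<comment> \<open>\<open>k\<close> replaces the coordinate at \<open>x0\<close>. Given
      \<open>k\<close>, the degree in \<open>X \<union> Y\<close> returns the coordinate at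
      \<open>x0\<close>, and then the degree in \<open>Y \<union> Z\<close> returns that at
      \<open>z0\<close>.\<close>
    let ?F = "\<lambda>(u, k). \<lambda>v\<in>UNIV - {z0}. if v = x0 then k else lookup u v"
    show "?F p \<in> (UNIV - {z0}) \<rightarrow>\<^sub>E {..?M}" if "p \<in> B1" for p
    proof -
      obtain u k where p: "p = (u, k)" by (cases p)
      have "lookup u v \<le> ?M" for v
        using that UNIV leP[of v u k] leQ[of v u k] by (auto simp: B1_def p)
      then show ?thesis
        using that le(3) by (simp add: p restrict_PiE_iff B1_def)
    qed
    show "inj_on ?F B1"
    proof (rule inj_onI)
      fix p q assume p: "p \<in> B1" and q: "q \<in> B1" and eq: "?F p = ?F q"
      obtain u k u' k' where pq: "p = (u, k)" "q = (u', k')" by (cases p, cases q) auto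
      have eq': "(if v = x0 then k else lookup u v) = (if v = x0 then k' else lookup u' v)" if "v \<noteq> z0" for v
        using fun_cong[OF eq, of v] that by (simp add: pq)
      have "x0 \<noteq> z0" using x0 z0 disj by blast
      then have k: "k = k'" using eq'[of x0] by simp
      have other: "lookup u v = lookup u' v" if "v \<noteq> z0" "v \<noteq> x0" for v
        using eq'[of v] that by simp
      have "deg_in (X \<union> Y - {x0}) u = deg_in (X \<union> Y - {x0}) u'"
      proof (rule deg_in_cong)
        fix v assume v: "v \<in> X \<union> Y - {x0}"
        then have "v \<noteq> z0" using z0 disj by blast
        then show "lookup u v = lookup u' v" using other v by blast
      qed
      moreover have "deg_in (X \<union> Y) u = deg_in (X \<union> Y) u'"
        using p q k by (simp add: B1_def pq)
      ultimately have "lookup u x0 = lookup u' x0"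
        using x0 by (simp add: deg_in_remove[of x0 "X \<union> Y"])
      then have "lookup u v = lookup u' v" if "v \<noteq> z0" for v
        using other that by (cases "v = x0") auto
      moreover have "deg_in (Y \<union> Z) u = deg_in (Y \<union> Z) u'"
        using p q k by (simp add: B1_def pq)
      ultimately have "u = u'" using z0 by (intro exp_eqI[of z0 u u' "Y \<union> Z"]) auto
      then show "p = q" using k pq by simp
    qed
  qed
  moreover have "finite B2 \<and> card B2 \<le> (?M + 1) ^ (card (UNIV :: 'v set) - 1)"
  proof (rule box_bound)
    \<comment> \<open>The coordinate at \<open>z0\<close> is 0 in this family, and \<open>k\<close>
      follows from the degree in \<open>X \<union> Y\<close> because \<open>a\<close> is
      positive.\<close>
    let ?F = "\<lambda>(u, k :: nat). \<lambda>v\<in>UNIV - {z0}. lookup u v"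
    show "?F p \<in> (UNIV - {z0}) \<rightarrow>\<^sub>E {..?M}" if "p \<in> B2" for p
    proof -
      obtain u k where p: "p = (u, k)" by (cases p)
      have "lookup u v \<le> ?M" for v
      proof (cases "v \<in> Z")
        case True
        then show ?thesis using that by (simp add: B2_def p deg_in_eq_0_iff)
      next
        case False
        then have "v \<in> X \<union> Y" using UNIV by blast
        then show ?thesis using that leP[of v u k] by (simp add: B2_def p)
      qed
      then show ?thesis
        by (simp add: p restrict_PiE_iff)
    qed
    show "inj_on ?F B2"
    proof (rule inj_onI)
      fix p q assume p: "p \<in> B2" and q: "q \<in> B2" and eq: "?F p = ?F q"
      obtain u k u' k' where pq: "p = (u, k)" "q = (u', k')" by (cases p, cases q) auto
      have "lookup u v = lookup u' v" if "v \<noteq> z0" for v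
        using fun_cong[OF eq, of v] that by (simp add: pq)
      then have "u = u'"
        using p q z0 by (intro exp_eqI[of z0 u u' Z]) (auto simp: B2_def pq)
      moreover from this have "k = k'" using p q a by (auto simp: B2_def pq)
      ultimately show "p = q" using pq by simp
    qed
  qed
  moreover have "finite B3 \<and> card B3 \<le> (?M + 1) ^ (card (UNIV :: 'v set) - 1)"
  proof (rule box_bound)
    \<comment> \<open>Here the coordinate at \<open>x0\<close> is 0, and \<open>k\<close> follows
      from the degree in \<open>Y \<union> Z\<close> because \<open>b\<close> is positive.\<close>
    let ?F = "\<lambda>(u, k :: nat). \<lambda>v\<in>UNIV - {x0}. lookup u v"
    show "?F p \<in> (UNIV - {x0}) \<rightarrow>\<^sub>E {..?M}" if "p \<in> B3" for p
    proof -
      obtain u k where p: "p = (u, k)" by (cases p)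
      have "lookup u v \<le> ?M" for v
      proof (cases "v \<in> X")
        case True
        then show ?thesis using that by (simp add: B3_def p deg_in_eq_0_iff)
      next
        case False
        then have "v \<in> Y \<union> Z" using UNIV by blast
        then show ?thesis using that leQ[of v u k] by (simp add: B3_def p)
      qed
      then show ?thesis
        by (simp add: p restrict_PiE_iff)
    qed
    show "inj_on ?F B3"
    proof (rule inj_onI)
      fix p q assume p: "p \<in> B3" and q: "q \<in> B3" and eq: "?F p = ?F q"
      obtain u k u' k' where pq: "p = (u, k)" "q = (u', k')" by (cases p, cases q) auto
      have "lookup u v = lookup u' v" if "v \<noteq> x0" for v
        using fun_cong[OF eq, of v] that by (simp add: pq)
      then have "u = u'"
        using p q x0 by (intro exp_eqI[of x0 u u' X]) (auto simp: B3_def pq)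
      moreover from this have "k = k'" using p q b by (auto simp: B3_def pq)
      ultimately show "p = q" using pq by simp
    qed
  qed
  ultimately show "finite B" "card B \<le> 3 * (?M + 1) ^ (card (UNIV :: 'v set) - 1)"
    unfolding B using card_Un_le[of "B1 \<union> B2" B3] card_Un_le[of B1 B2] by auto
qed

text \<open>The Rees algebra inside the type of univariate polynomials;
  \<open>rees_algebra_simps\<close> identifies it with \<open>rees_algebra\<close> by means of
  \<open>poly.coeff\<close>.\<close>

definition rees_polys :: "(('v \<Rightarrow>\<^sub>0 nat) \<Rightarrow>\<^sub>0 'k::field) poly set"
  where "rees_polys = {p. \<forall>k. Polynomial.coeff p k \<in> mon_ideal (U k)}"

lemma U_add: "u \<in> U i \<Longrightarrow> w \<in> U j \<Longrightarrow> u + w \<in> U (i + j)"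
  by (auto simp: rees_exps_def deg_in_add add_mult_distrib2 intro: add_mono)

lemma U_0 [simp]: "U 0 = UNIV"
  by (simp add: rees_exps_def)

lemma subring_rees_polys: "subring_of (rees_polys :: (('v \<Rightarrow>\<^sub>0 nat) \<Rightarrow>\<^sub>0 'k::field) poly set)"
  unfolding subring_of_def
proof (intro conjI ballI)
  show "1 \<in> (rees_polys :: (('v \<Rightarrow>\<^sub>0 nat) \<Rightarrow>\<^sub>0 'k::field) poly set)"
    by (auto simp: rees_polys_def coeff_1 mon_ideal_def)
  fix x y :: "(('v \<Rightarrow>\<^sub>0 nat) \<Rightarrow>\<^sub>0 'k) poly" assume x: "x \<in> rees_polys"
  have "- f \<in> mon_ideal V" if "f \<in> mon_ideal V" for f :: "('v \<Rightarrow>\<^sub>0 nat) \<Rightarrow>\<^sub>0 'k" and V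
  proof -
    have "keys (- f) = keys f" by (auto simp add: in_keys_iff simp del: lookup_not_eq_zero_eq_in_keys)
    then show ?thesis using that by (simp add: mon_ideal_def)
  qed
  then show "- x \<in> rees_polys" using x by (simp add: rees_polys_def)
  assume y: "y \<in> rees_polys"
  show "x + y \<in> rees_polys" using x y by (simp add: rees_polys_def mon_ideal_add)
  show "x * y \<in> rees_polys"
    unfolding rees_polys_def mem_Collect_eq coeff_mult
  proof (intro allI mon_ideal_sum)
    fix k i :: nat assume "i \<in> {..k}"
    then have "u + v \<in> U k" if "u \<in> U i" "v \<in> U (k - i)" for u v
      using U_add[OF that] by simp
    then show "Polynomial.coeff x i * Polynomial.coeff y (k - i) \<in> mon_ideal (U k)"
      using x y by (intro mon_ideal_mult[of _ "U i" _ "U (k - i)"]) (auto simp: rees_polys_def)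
  qed
qed

definition const :: "'k::field \<Rightarrow> (('v \<Rightarrow>\<^sub>0 nat) \<Rightarrow>\<^sub>0 'k) poly"
  where "const c = [:Poly_Mapping.single 0 c:]"

lemma const_mem: "const c \<in> rees_polys"
  by (auto simp: const_def rees_polys_def coeff_pCons mon_ideal_def split: nat.split)

lemma const_mult: "const c * const d = const (c * d)"
  by (simp add: const_def mult_single mult.commute)

lemma lookup_coeff_const_mult:
  fixes c :: "'k::field"
  shows "lookup (Polynomial.coeff (const c * p) k) u = c * lookup (Polynomial.coeff p k) u"
proof -
  have "lookup (Poly_Mapping.single 0 c * q) u = c * lookup q u" for q :: "('v \<Rightarrow>\<^sub>0 nat) \<Rightarrow>\<^sub>0 'k"
    unfolding mult_map_scale_conv_mult[symmetric] by (simp add: Poly_Mapping.map.rep_eq when_def)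
  then show ?thesis by (simp add: const_def)
qed

text \<open>A nonzero constant is a unit of \<open>rees_polys\<close>.\<close>

lemma const_notin_prime:
  assumes "prime_in rees_polys P" "c \<noteq> 0"
  shows "const c \<notin> P"
proof
  assume "const c \<in> P"
  then have "const (1 / c) * const c \<in> P"
    using const_mem by (intro prime_inD(4)[OF assms(1)])
  moreover have "const (1 / c) * const c = 1"
    using assms(2) by (simp add: const_mult) (simp add: const_def one_pCons)
  ultimately show False using prime_inD(6)[OF assms(1)] by simp
qed

text \<open>By \<open>var\<close>, only reduced exponents count modulo \<open>P 0\<close>. Elements
  separating consecutive primes have more power products than there are such exponents in the
  relevant degrees, which yields a relation that \<open>prime_chain_independent\<close>
  forbids.\<close>

proposition no_long_prime_chain:
  fixes P :: "nat \<Rightarrow> (('v \<Rightarrow>\<^sub>0 nat) \<Rightarrow>\<^sub>0 'k::field) poly set"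
  assumes P: "\<And>i. i \<le> card (UNIV :: 'v set) \<Longrightarrow> prime_in rees_polys (P i)"
    and chain: "\<And>i. i < card (UNIV :: 'v set) \<Longrightarrow> P i \<subset> P (Suc i)"
    and var: "\<And>v w c k. w \<in> U k \<Longrightarrow> Polynomial.monom (Poly_Mapping.single (Poly_Mapping.single v 1 + w) c) k \<in> P 0"
  shows False
proof -
  let ?n = "card (UNIV :: 'v set)"
  have "\<exists>f. f \<in> P (Suc i) - P i" if "i < ?n" for i using chain[OF that] by blast
  then obtain g where g: "\<And>i. i < ?n \<Longrightarrow> g i \<in> P (Suc i) - P i" by metis
  define fs where "fs = map g [0..<?n]"
  have len: "length fs = ?n" and nth: "\<And>i. i < ?n \<Longrightarrow> fs ! i = g i" by (auto simp: fs_def)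
  have fsS: "set fs \<subseteq> rees_polys"
  proof
    fix f assume "f \<in> set fs"
    then obtain i where "i < ?n" "f = g i" by (auto simp: fs_def)
    then show "f \<in> rees_polys" using g[of i] prime_inD(1)[OF P[of "Suc i"]] by auto
  qed
  define D where "D = Max (insert 0 (Polynomial.degree ` set fs))"
  have D: "Polynomial.degree f \<le> D" if "f \<in> set fs" for f
    unfolding D_def using that by (intro Max_ge) auto
  \<comment> \<open>The constants are chosen such that
    \<open>(a + b) * L + 1 \<le> K * (N + 1)\<close>. Then at most
    \<open>N * (N + 1) ^ (?n - 1)\<close> reduced exponents stand against
    \<open>(N + 1) ^ ?n\<close> power products.\<close>
  define K where "K = (a + b) * (?n * D) + 1"
  define N where "N = 3 * K ^ (?n - 1)"
  define L where "L = ?n * (N * D)"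
  define A where "A = {e :: nat list. set e \<subseteq> {..N} \<and> length e = ?n}"
  define B where "B = {(u, k). (u, k) \<in> reduced \<and> k \<le> L}"
  have finA: "finite A" unfolding A_def by (intro finite_lists_length_eq) simp
  have cardA: "card A = (N + 1) ^ ?n" unfolding A_def by (subst card_lists_length_eq) simp_all
  have finB: "finite B" and cardB: "card B \<le> 3 * ((a + b) * L + 1) ^ (?n - 1)"
    using card_reduced[of L] by (simp_all add: B_def)
  have "(a + b) * L + 1 \<le> K * (N + 1)"
    by (simp add: K_def L_def algebra_simps)
  then have "((a + b) * L + 1) ^ (?n - 1) \<le> K ^ (?n - 1) * (N + 1) ^ (?n - 1)"
    unfolding power_mult_distrib[symmetric] by (intro power_mono) auto
  then have "card B \<le> N * (N + 1) ^ (?n - 1)"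
    using cardB by (simp add: N_def)
  also have "\<dots> < (N + 1) * (N + 1) ^ (?n - 1)" by simp
  also have "\<dots> = card A"
    unfolding cardA by (metis One_nat_def Suc_pred' UNIV_not_empty card_gt_0_iff finite_UNIV power_Suc)
  finally have "card B < card A" .
  \<comment> \<open>One unknown per power product and one equation per reduced exponent: the
    combination is to have coefficient 0 there.\<close>
  from exists_linear_dependence[OF finB finA this,
      of "\<lambda>e (u, k). lookup (Polynomial.coeff (mono_prod fs e) k) u"]
  obtain c where c: "\<exists>e\<in>A. c e \<noteq> 0"
    "\<And>u k. (u, k) \<in> B \<Longrightarrow> (\<Sum>e\<in>A. c e * lookup (Polynomial.coeff (mono_prod fs e) k) u) = 0"
    by fastforce
  \<comment> \<open>Independence asks for coefficients outside all the primes, so zero coefficients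
    are dropped.\<close>
  define E where "E = {e \<in> A. c e \<noteq> 0}"
  define h where "h = (\<Sum>e\<in>E. const (c e) * mono_prod fs e)"
  have mS: "mono_prod fs e \<in> rees_polys" for e
    by (rule mono_prod_closed[OF subring_rees_polys fsS])
  have hS: "h \<in> rees_polys"
    unfolding h_def
    by (intro subring_of_sum[OF subring_rees_polys] subring_ofD(5)[OF subring_rees_polys] const_mem mS)
  have lookup_h: "lookup (Polynomial.coeff h k) u = (\<Sum>e\<in>A. c e * lookup (Polynomial.coeff (mono_prod fs e) k) u)" for k u
  proof -
    have "lookup (Polynomial.coeff h k) u = (\<Sum>e\<in>E. c e * lookup (Polynomial.coeff (mono_prod fs e) k) u)"
      by (simp add: h_def coeff_sum lookup_sum lookup_coeff_const_mult)
    also have "\<dots> = (\<Sum>e\<in>A. c e * lookup (Polynomial.coeff (mono_prod fs e) k) u)"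
      using finA by (intro sum.mono_neutral_left) (auto simp: E_def)
    finally show ?thesis .
  qed
  \<comment> \<open>Every term left in \<open>h\<close> has an exponent that is not reduced, so it
    is a variable times a term of the Rees algebra and \<open>var\<close> applies.\<close>
  have "h \<in> P 0"
  proof (rule poly_mem_by_monomials)
    fix k u assume nz: "lookup (Polynomial.coeff h k) u \<noteq> 0"
    then have "(u, k) \<notin> B" using c(2)[of u k] lookup_h by auto
    \<comment> \<open>The equations say nothing beyond \<open>L\<close>, but \<open>L\<close> bounds
      the degree of all power products used.\<close>
    moreover have "k \<le> L"
    proof (rule ccontr)
      assume "\<not> k \<le> L"
      then have "Polynomial.coeff (mono_prod fs e) k = 0" if "e \<in> A" for e
        using degree_mono_prod[of e fs D N] that D len
        by (intro coeff_eq_0) (auto simp: A_def L_def)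
      then show False using nz by (simp add: lookup_h)
    qed
    ultimately have "(u, k) \<notin> reduced" by (simp add: B_def)
    moreover have "u \<in> U k"
      using hS nz unfolding rees_polys_def mon_ideal_def in_keys_iff subset_iff by simp
    ultimately obtain v w where "u = Poly_Mapping.single v 1 + w" "w \<in> U k"
      using not_reduced_split by blast
    then show "Polynomial.monom (Poly_Mapping.single u (lookup (Polynomial.coeff h k) u)) k \<in> P 0"
      using var by simp
  qed (use prime_inD(2,3)[OF P[of 0]] in auto)
  moreover have "h \<notin> P 0"
    unfolding h_def
  proof (rule prime_chain_independent[OF subring_rees_polys])
    show "finite E" using finA by (simp add: E_def)
    show "E \<noteq> {}" using c(1) by (auto simp: E_def)
    show "const (c e) \<notin> P i" if "e \<in> E" "i \<le> length fs" for e i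
      using that const_notin_prime[OF P[of i]] by (simp add: E_def len)
  qed (use P chain g nth len in \<open>auto simp: E_def A_def const_mem\<close>)
  ultimately show False by simp
qed

end

subsection \<open>The Rees algebra as a ring of polynomials\<close>

lemma finsum_mpoly_ring:
  fixes f :: "'a \<Rightarrow> (('v::finite \<Rightarrow>\<^sub>0 nat) \<Rightarrow>\<^sub>0 'k::field)"
  assumes "finite A"
  shows "finsum mpoly_ring f A = sum f A"
proof -
  interpret cring "mpoly_ring :: (('v \<Rightarrow>\<^sub>0 nat) \<Rightarrow>\<^sub>0 'k) ring" by (rule cring_mpoly_ring)
  show ?thesis using assms by (induction A rule: finite_induct) simp_all
qed

lemma poly_coeff_mem_up: "poly.coeff p \<in> up (mpoly_ring :: (('v::finite \<Rightarrow>\<^sub>0 nat) \<Rightarrow>\<^sub>0 'k::field) ring)"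
  by (rule mem_upI) (auto intro!: exI[of _ "Polynomial.degree p"] simp: bound_def Polynomial.coeff_eq_0)

lemma up_mpoly_ring_coeff:
  assumes "f \<in> up (mpoly_ring :: (('v::finite \<Rightarrow>\<^sub>0 nat) \<Rightarrow>\<^sub>0 'k::field) ring)"
  shows "\<exists>p. f = poly.coeff p"
proof -
  obtain n where "bound 0 n f" using assms by (auto simp: up_def)
  then have "poly.coeff (Abs_poly f) = f"
    by (intro coeff_Abs_poly[of n]) (simp add: bound_def)
  then show ?thesis by metis
qed

text \<open>Elements of \<open>UP\<close> are bare coefficient functions, so
  \<open>poly.coeff\<close> is the isomorphism by which the polynomial type replaces this
  ring.\<close>

lemma carrier_UP_mpoly_ring:
  "carrier (UP (mpoly_ring :: (('v::finite \<Rightarrow>\<^sub>0 nat) \<Rightarrow>\<^sub>0 'k::field) ring)) = range poly.coeff"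
  using poly_coeff_mem_up up_mpoly_ring_coeff by (force simp: UP_def)

lemma UP_mpoly_ring_simps:
  fixes p q :: "(('v::finite \<Rightarrow>\<^sub>0 nat) \<Rightarrow>\<^sub>0 'k::field) poly"
  shows "poly.coeff p \<otimes>\<^bsub>UP mpoly_ring\<^esub> poly.coeff q = poly.coeff (p * q)"
    and "poly.coeff p \<oplus>\<^bsub>UP mpoly_ring\<^esub> poly.coeff q = poly.coeff (p + q)"
    and "\<one>\<^bsub>UP mpoly_ring\<^esub> = poly.coeff (1 :: (('v \<Rightarrow>\<^sub>0 nat) \<Rightarrow>\<^sub>0 'k) poly)"
    and "\<zero>\<^bsub>UP mpoly_ring\<^esub> = poly.coeff (0 :: (('v \<Rightarrow>\<^sub>0 nat) \<Rightarrow>\<^sub>0 'k) poly)"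
    and "up_ring.coeff (UP mpoly_ring) (poly.coeff p) = poly.coeff p"
    and "up_ring.monom (UP mpoly_ring) r 0 = poly.coeff [:r :: ('v \<Rightarrow>\<^sub>0 nat) \<Rightarrow>\<^sub>0 'k:]"
  by (auto simp: UP_def poly_coeff_mem_up fun_eq_iff finsum_mpoly_ring coeff_mult coeff_1 coeff_pCons
      split: nat.split)

locale two_primes_ideal = two_primes X Y Z a b x0 z0
  for X Y Z :: "'v::finite set" and a b :: nat and x0 z0 :: 'v +
  fixes I :: "(('v \<Rightarrow>\<^sub>0 nat) \<Rightarrow>\<^sub>0 'k::field) set"
  assumes ideal_power_I: "ideal_power mpoly_ring I k = mon_ideal (U k)"
begin

abbreviation R :: "(('v \<Rightarrow>\<^sub>0 nat) \<Rightarrow>\<^sub>0 'k) ring" where "R \<equiv> mpoly_ring"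
abbreviation "A \<equiv> rees_algebra R I"
abbreviation "\<mm> \<equiv> Idl\<^bsub>R\<^esub> (range mpoly_var)"

lemma rees_algebra_simps:
  "carrier A = poly.coeff ` rees_polys"
  "poly.coeff p \<otimes>\<^bsub>A\<^esub> poly.coeff q = poly.coeff (p * q)"
  "poly.coeff p \<oplus>\<^bsub>A\<^esub> poly.coeff q = poly.coeff (p + q)"
  "\<one>\<^bsub>A\<^esub> = poly.coeff 1" "\<zero>\<^bsub>A\<^esub> = poly.coeff 0"
  by (auto simp: rees_algebra_def ideal_power_I carrier_UP_mpoly_ring UP_mpoly_ring_simps rees_polys_def)

lemma cring_A: "cring A"
proof (rule cringI)
  note closed = subring_ofD[OF subring_rees_polys]
  show "abelian_group A"
  proof (rule abelian_groupI)
    fix x assume "x \<in> carrier A"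
    then obtain p where "p \<in> rees_polys" "x = poly.coeff p" by (auto simp: rees_algebra_simps)
    then show "\<exists>y\<in>carrier A. y \<oplus>\<^bsub>A\<^esub> x = \<zero>\<^bsub>A\<^esub>"
      by (intro bexI[of _ "poly.coeff (- p)"]) (auto simp: rees_algebra_simps closed simp del: coeff_minus)
  qed (auto simp: rees_algebra_simps closed add.assoc intro: arg_cong[OF add.commute]
      simp del: coeff_add coeff_0)
  show "comm_monoid A"
    by (rule comm_monoidI)
      (auto simp: rees_algebra_simps closed mult.assoc intro: arg_cong[OF mult.commute] simp del: coeff_1)
qed (auto simp: rees_algebra_simps distrib_right simp del: coeff_add)

lemma \<mm>_eq: "\<mm> = mon_ideal {u. 1 \<le> deg_in UNIV u}"
  by (rule genideal_vars)

lemma ideal_\<mm>: "ideal \<mm> R"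
  unfolding \<mm>_eq by (rule ideal_mon_ideal) (auto simp: up_closed_def deg_in_add)

lemma const_poly_mem: "[:r:] \<in> rees_polys"
  by (auto simp: rees_polys_def coeff_pCons mon_ideal_def split: nat.split)

sublocale tensor_setting R A "R Quot \<mm>" "\<lambda>r. up_ring.monom (UP R) r 0" "\<lambda>r. \<mm> +>\<^bsub>R\<^esub> r"
proof (intro tensor_setting.intro tensor_setting_axioms.intro)
  show "cring A" by (rule cring_A)
  show "cring (R Quot \<mm>)" by (rule ideal.quotient_is_cring[OF ideal_\<mm> cring_mpoly_ring])
  show "cring R" by (rule cring_mpoly_ring)
  show "up_ring.monom (UP R) r 0 \<in> carrier A" for r
    by (simp add: UP_mpoly_ring_simps rees_algebra_simps const_poly_mem)
  show "\<mm> +>\<^bsub>R\<^esub> r \<in> carrier (R Quot \<mm>)" for r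
    using ring_hom_closed[OF ideal.rcos_ring_hom[OF ideal_\<mm>], of r] by simp
qed

lemma analytic_spread_eq: "analytic_spread R \<mm> I = krull_dim T"
  by (simp add: analytic_spread_def)

text \<open>The residue map of \<open>R\<close> is onto, so every tensor is the image of an element
  of the Rees algebra.\<close>

lemma left_surj_polys:
  assumes "t \<in> carrier T"
  shows "\<exists>p\<in>rees_polys. t = left (poly.coeff p)"
proof -
  have "\<exists>x\<in>carrier A. t = left x"
  proof (rule left_surj)
    show "\<exists>r\<in>carrier R. B = \<mm> +>\<^bsub>R\<^esub> r" if "B \<in> carrier (R Quot \<mm>)" for B
      using that unfolding FactRing_def A_RCOSETS_def' partial_object.simps by blast
  qed fact
  then show ?thesis by (auto simp: rees_algebra_simps(1))
qed

text \<open>The composite of \<open>poly.coeff\<close> and \<open>left\<close> respects sums,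
  products, 0 and 1 on \<open>rees_polys\<close>, so primality pulls back along it.\<close>

lemma prime_in_vimage:
  assumes "primeideal P T"
  shows "prime_in rees_polys {p \<in> rees_polys. left (poly.coeff p) \<in> P}"
proof -
  interpret P: primeideal P T by fact
  interpret l: ring_hom_ring A T left by (rule left_hom)
  note closed = subring_ofD[OF subring_rees_polys]
  have mem: "poly.coeff p \<in> carrier A" if "p \<in> rees_polys" for p
    using that by (simp add: rees_algebra_simps(1))
  have add: "left (poly.coeff (p + q)) = left (poly.coeff p) \<oplus>\<^bsub>T\<^esub> left (poly.coeff q)"
    and mult: "left (poly.coeff (p * q)) = left (poly.coeff p) \<otimes>\<^bsub>T\<^esub> left (poly.coeff q)"
    if "p \<in> rees_polys" "q \<in> rees_polys" for p q
    unfolding rees_algebra_simps(2,3)[symmetric] using l.hom_add l.hom_mult mem that by blast+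
  have zero: "left (poly.coeff 0) = \<zero>\<^bsub>T\<^esub>"
    unfolding rees_algebra_simps(5)[symmetric] by (rule l.hom_zero)
  have one: "left (poly.coeff 1) = \<one>\<^bsub>T\<^esub>"
    unfolding rees_algebra_simps(4)[symmetric] by (rule l.hom_one)
  have carr: "left (poly.coeff p) \<in> carrier T" if "p \<in> rees_polys" for p
    using l.hom_closed[OF mem[OF that]] .
  show ?thesis
    unfolding prime_in_def
  proof (intro conjI ballI impI)
    show "0 \<in> {p \<in> rees_polys. left (poly.coeff p) \<in> P}"
      using closed(2) P.zero_closed unfolding mem_Collect_eq zero by blast
    show "1 \<notin> {p \<in> rees_polys. left (poly.coeff p) \<in> P}"
      using P.one_imp_carrier P.I_notcarr unfolding mem_Collect_eq one by blast
    show "x + y \<in> {p \<in> rees_polys. left (poly.coeff p) \<in> P}"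
      if "x \<in> {p \<in> rees_polys. left (poly.coeff p) \<in> P}" "y \<in> {p \<in> rees_polys. left (poly.coeff p) \<in> P}" for x y
      using that P.a_closed add[of x y] closed(3)[of x y] by (simp del: coeff_add)
    show "x * y \<in> {p \<in> rees_polys. left (poly.coeff p) \<in> P}"
      if "x \<in> rees_polys" "y \<in> {p \<in> rees_polys. left (poly.coeff p) \<in> P}" for x y
      using that P.I_l_closed carr mult[of x y] closed(5)[of x y] by simp
    show "x \<in> {p \<in> rees_polys. left (poly.coeff p) \<in> P} \<or> y \<in> {p \<in> rees_polys. left (poly.coeff p) \<in> P}"
      if "x \<in> rees_polys" "y \<in> rees_polys" "x * y \<in> {p \<in> rees_polys. left (poly.coeff p) \<in> P}" for x y
      using that P.I_prime[OF carr carr, of x y] mult[of x y] by simp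
  qed auto
qed

text \<open>Pulled back to the Rees algebra, a chain stays strict because \<open>left\<close> is
  surjective, and its first prime contains the kernel of \<open>left\<close>, hence all variables
  times terms. So \<open>no_long_prime_chain\<close> applies.\<close>

lemma krull_dim_upper:
  assumes P: "\<And>i. i \<le> N \<Longrightarrow> primeideal (P i) T" and chain: "\<And>i. i < N \<Longrightarrow> P i \<subset> P (Suc i)"
  shows "N < card (UNIV :: 'v set)"
proof (rule ccontr)
  assume "\<not> N < card (UNIV :: 'v set)"
  \<comment> \<open>Only the first \<open>card UNIV + 1\<close> primes of the chain are
    used.\<close>
  then have le: "card (UNIV :: 'v set) \<le> N" by simp
  define Q where "Q i = {p \<in> rees_polys. left (poly.coeff p) \<in> P i}" for i
  show False
  proof (rule no_long_prime_chain)
    show "prime_in rees_polys (Q i)" if "i \<le> card (UNIV :: 'v set)" for i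
      unfolding Q_def using that le by (intro prime_in_vimage P) simp
    show "Q i \<subset> Q (Suc i)" if "i < card (UNIV :: 'v set)" for i
    proof -
      have i: "i < N" "Suc i \<le> N" using that le by auto
      obtain t where t: "t \<in> P (Suc i)" "t \<notin> P i" using chain[OF i(1)] by blast
      have "t \<in> carrier T" using t(1) ideal.Icarr[OF primeideal.axioms(1)[OF P[OF i(2)]]] by blast
      then obtain p where p: "p \<in> rees_polys" "t = left (poly.coeff p)" using left_surj_polys by blast
      have "p \<in> Q (Suc i)" "p \<notin> Q i" using p t by (auto simp: Q_def)
      moreover have "Q i \<subseteq> Q (Suc i)" using chain[OF i(1)] by (auto simp: Q_def)
      ultimately show ?thesis by blast
    qed
    fix v w k and c :: 'k assume w: "w \<in> U k"
    let ?q = "Polynomial.monom (Poly_Mapping.single w c) k"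
    have var_mem: "mpoly_var v \<in> \<mm>"
      unfolding \<mm>_eq mpoly_var_def by (rule mon_ideal_single) (simp add: deg_in_single)
    have qS: "?q \<in> rees_polys"
      using w by (auto simp: rees_polys_def coeff_monom mon_ideal_single)
    \<comment> \<open>A constant polynomial from \<open>\<mm>\<close> times an element of the Rees
      algebra: the form that \<open>left_kernel\<close> sends to 0.\<close>
    have eq: "Polynomial.monom (Poly_Mapping.single (Poly_Mapping.single v 1 + w) c) k = [:mpoly_var v:] * ?q"
      by (simp add: mpoly_var_def smult_monom mult_single)
    have "\<mm> +>\<^bsub>R\<^esub> mpoly_var v = \<zero>\<^bsub>R Quot \<mm>\<^esub>"
      using ring.a_rcos_zero[OF cring.axioms(1)[OF cring_mpoly_ring] ideal_\<mm> var_mem] by (simp add: FactRing_def)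
    then have "left (poly.coeff ([:mpoly_var v:] * ?q)) = \<zero>\<^bsub>T\<^esub>"
      using left_kernel[of "mpoly_var v" "poly.coeff ?q"] qS
      by (simp add: UP_mpoly_ring_simps rees_algebra_simps)
    moreover have "\<zero>\<^bsub>T\<^esub> \<in> P 0"
      using additive_subgroup.zero_closed[OF ideal.axioms(1)[OF primeideal.axioms(1)[OF P[of 0]]]] by simp
    moreover have "[:mpoly_var v:] * ?q \<in> rees_polys"
      by (rule subring_ofD(5)[OF subring_rees_polys const_poly_mem qS])
    ultimately show "Polynomial.monom (Poly_Mapping.single (Poly_Mapping.single v 1 + w) c) k \<in> Q 0"
      unfolding Q_def eq by simp
  qed
qed

end

subsection \<open>The lower bound\<close>

definition avoiding :: "'v set \<Rightarrow> ('v \<Rightarrow>\<^sub>0 nat) \<Rightarrow> bool"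
  where "avoiding J u \<longleftrightarrow> (\<forall>v\<in>J. lookup u v = 0)"

lemma avoiding_add: "avoiding J (u + w) \<longleftrightarrow> avoiding J u \<and> avoiding J w"
  by (auto simp: avoiding_def lookup_add)

text \<open>This is the kernel of setting the variables in \<open>J\<close> to 0. That map is
  multiplicative, since a sum of exponents avoids \<open>J\<close> only if both summands do, and its
  values lie in a ring without zero divisors.\<close>

lemma primeideal_vars:
  "primeideal {f. restr (avoiding J) f = 0} (mpoly_ring :: (('v::finite \<Rightarrow>\<^sub>0 nat) \<Rightarrow>\<^sub>0 'k::field) ring)"
proof (rule primeidealI[OF _ cring_mpoly_ring])
  have mult: "restr (avoiding J) (f * g) = restr (avoiding J) f * restr (avoiding J) g"
    for f g :: "('v \<Rightarrow>\<^sub>0 nat) \<Rightarrow>\<^sub>0 'k"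
    by (rule restr_mult_face) (rule avoiding_add)
  show "ideal {f. restr (avoiding J) f = 0} (mpoly_ring :: (('v \<Rightarrow>\<^sub>0 nat) \<Rightarrow>\<^sub>0 'k) ring)"
    by (rule ideal_mpoly_ringI) (auto simp: restr_add mult)
  have "restr (avoiding J) (1 :: ('v \<Rightarrow>\<^sub>0 nat) \<Rightarrow>\<^sub>0 'k) = 1"
    by (rule restr_id) (simp add: avoiding_def)
  then have "(1 :: ('v \<Rightarrow>\<^sub>0 nat) \<Rightarrow>\<^sub>0 'k) \<notin> {f. restr (avoiding J) f = 0}" by simp
  then show "carrier mpoly_ring \<noteq> {f :: ('v \<Rightarrow>\<^sub>0 nat) \<Rightarrow>\<^sub>0 'k. restr (avoiding J) f = 0}" by auto
  fix f g :: "('v \<Rightarrow>\<^sub>0 nat) \<Rightarrow>\<^sub>0 'k"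
  assume "f \<otimes>\<^bsub>mpoly_ring\<^esub> g \<in> {f. restr (avoiding J) f = 0}"
  then show "f \<in> {f. restr (avoiding J) f = 0} \<or> g \<in> {f. restr (avoiding J) f = 0}"
    using mpoly_no_zero_divisors[of "restr (avoiding J) f" "restr (avoiding J) g"] by (auto simp: mult)
qed

section \<open>Restriction to the face\<close>

context two_primes_ideal
begin

definition face :: "nat \<Rightarrow> ('v \<Rightarrow>\<^sub>0 nat) \<Rightarrow> bool"
  where "face k u \<longleftrightarrow> deg_in (X \<union> Y) u = a * k \<and> deg_in (Y \<union> Z) u = b * k"

definition face_poly :: "(('v \<Rightarrow>\<^sub>0 nat) \<Rightarrow>\<^sub>0 'k) poly \<Rightarrow> (('v \<Rightarrow>\<^sub>0 nat) \<Rightarrow>\<^sub>0 'k) poly"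
  where "face_poly p = Abs_poly (\<lambda>k. restr (face k) (poly.coeff p k))"

lemma coeff_face_poly: "poly.coeff (face_poly p) k = restr (face k) (poly.coeff p k)"
  unfolding face_poly_def
  by (subst coeff_Abs_poly[of "Polynomial.degree p"]) (simp_all add: Polynomial.coeff_eq_0)

lemma face_poly_add: "face_poly (p + q) = face_poly p + face_poly q"
  by (rule poly_eqI) (simp add: coeff_face_poly restr_add)

text \<open>
  On \<open>U i\<close> and \<open>U j\<close> both degrees are bounded below, so the bounds of a sum of exponents are
  attained only if they are attained by both summands.
\<close>

lemma face_add: "u \<in> U i \<Longrightarrow> w \<in> U j \<Longrightarrow> face (i + j) (u + w) \<longleftrightarrow> face i u \<and> face j w"
  by (auto simp: face_def rees_exps_def deg_in_add add_mult_distrib2)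

lemma face_poly_mult:
  assumes "p \<in> rees_polys" "q \<in> rees_polys"
  shows "face_poly (p * q) = face_poly p * face_poly q"
proof (rule poly_eqI)
  fix k
  have "restr (face k) (poly.coeff p i * poly.coeff q (k - i)) =
      restr (face i) (poly.coeff p i) * restr (face (k - i)) (poly.coeff q (k - i))" if "i \<le> k" for i
  proof (rule restr_mult_face)
    fix u w assume "u \<in> keys (poly.coeff p i)" "w \<in> keys (poly.coeff q (k - i))"
    then have "u \<in> U i" "w \<in> U (k - i)" using assms unfolding rees_polys_def mon_ideal_def by blast+
    then show "face k (u + w) \<longleftrightarrow> face i u \<and> face (k - i) w" using face_add[of u i w "k - i"] that by simp
  qed
  then show "poly.coeff (face_poly (p * q)) k = poly.coeff (face_poly p * face_poly q) k"
    by (simp add: coeff_face_poly coeff_mult restr_sum)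
qed

lemma face_0: "face 0 u \<longleftrightarrow> u = 0"
proof -
  have "deg_in (X \<union> Y) u = 0 \<and> deg_in (Y \<union> Z) u = 0 \<longleftrightarrow> (\<forall>v. lookup u v = 0)"
    using UNIV by (auto simp: deg_in_eq_0_iff)
  then show ?thesis by (auto simp: face_def poly_mapping_eq_iff fun_eq_iff)
qed

text \<open>The constant term, as \<open>face_0\<close> shows. Written with \<open>face 0\<close>,
  it is multiplicative by \<open>face_add\<close> and agrees with \<open>face_eval\<close> on
  constant polynomials.\<close>

definition residue :: "(('v \<Rightarrow>\<^sub>0 nat) \<Rightarrow>\<^sub>0 'k) \<Rightarrow> (('v \<Rightarrow>\<^sub>0 nat) \<Rightarrow>\<^sub>0 'k)"
  where "residue = restr (face 0)"

lemma residue_mult: "residue (f * g) = residue f * residue g"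
  unfolding residue_def using face_add[of _ 0 _ 0] by (intro restr_mult_face) simp

lemma residue_1: "residue 1 = 1"
  unfolding residue_def by (rule restr_id) (simp add: face_0)

text \<open>The constant term vanishes on \<open>\<mm>\<close>, so it factors through the residue
  field.\<close>

lemma residue_lift:
  obtains \<epsilon> where "\<epsilon> \<in> ring_hom (R Quot \<mm>) R" "\<And>r. \<epsilon> (\<mm> +>\<^bsub>R\<^esub> r) = residue r"
proof -
  have "residue \<in> ring_hom R R"
    by (rule ring_hom_memI) (simp_all add: residue_mult residue_1, simp add: residue_def restr_add)
  moreover have "residue r = \<zero>\<^bsub>R\<^esub>" if "r \<in> \<mm>" for r
    using that unfolding \<mm>_eq residue_def mon_ideal_def
    by (auto intro!: restr_eq_0 simp: face_0)
  ultimately obtain \<epsilon> where "\<epsilon> \<in> ring_hom (R Quot \<mm>) R" "\<And>r. r \<in> carrier R \<Longrightarrow> \<epsilon> (\<mm> +>\<^bsub>R\<^esub> r) = residue r"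
    using FactRing_lift[OF cring_mpoly_ring ideal_\<mm> _ cring.axioms(1)[OF cring_mpoly_ring]] by blast
  then show thesis using that by simp
qed

text \<open>On the face, \<open>k\<close> is determined by the exponent because \<open>a\<close> is
  positive, so setting \<open>t\<close> to 1 merges no terms, and the values lie in the domain
  \<open>R\<close>.\<close>

definition face_eval :: "(('v \<Rightarrow>\<^sub>0 nat) \<Rightarrow>\<^sub>0 'k) poly \<Rightarrow> (('v \<Rightarrow>\<^sub>0 nat) \<Rightarrow>\<^sub>0 'k)"
  where "face_eval p = poly (face_poly p) 1"

lemma face_eval_add: "face_eval (p + q) = face_eval p + face_eval q"
  by (simp add: face_eval_def face_poly_add)

lemma face_eval_mult: "p \<in> rees_polys \<Longrightarrow> q \<in> rees_polys \<Longrightarrow> face_eval (p * q) = face_eval p * face_eval q"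
  by (simp add: face_eval_def face_poly_mult)

lemma face_eval_monom: "face_eval (Polynomial.monom f k) = restr (face k) f"
proof -
  have "face_poly (Polynomial.monom f k) = Polynomial.monom (restr (face k) f) k"
    by (rule poly_eqI) (simp add: coeff_face_poly coeff_monom)
  then show ?thesis by (simp add: face_eval_def poly_monom)
qed

lemma face_eval_const: "face_eval [:r:] = residue r"
  using face_eval_monom[of r 0] by (simp add: residue_def monom_0)

text \<open>The product of \<open>face_eval\<close> on the Rees algebra and the constant term on the
  residue field is balanced over \<open>R\<close>, because \<open>face_eval\<close> takes
  \<open>[:r:]\<close> to the constant term of \<open>r\<close>. The universal property of the
  tensor product then gives \<open>H\<close>.\<close>

lemma face_eval_lift:
  obtains H where "ring_hom_ring T R H" "\<And>p. p \<in> rees_polys \<Longrightarrow> H (left (poly.coeff p)) = face_eval p"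
proof -
  obtain \<epsilon> where \<epsilon>: "\<epsilon> \<in> ring_hom (R Quot \<mm>) R" "\<And>r. \<epsilon> (\<mm> +>\<^bsub>R\<^esub> r) = residue r"
    by (rule residue_lift) blast
  define \<eta> where "\<eta> x = face_eval (Abs_poly (fst x)) * \<epsilon> (snd x)" for x
  have \<eta>: "\<eta> (poly.coeff p, B) = face_eval p * \<epsilon> B" for p B
    by (simp add: \<eta>_def Polynomial.coeff_inverse)
  have \<epsilon>_simps: "\<epsilon> (B \<otimes>\<^bsub>R Quot \<mm>\<^esub> C) = \<epsilon> B * \<epsilon> C" "\<epsilon> (B \<oplus>\<^bsub>R Quot \<mm>\<^esub> C) = \<epsilon> B + \<epsilon> C"
    if "B \<in> carrier (R Quot \<mm>)" "C \<in> carrier (R Quot \<mm>)" for B C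
    using ring_hom_mult[OF \<epsilon>(1) that] ring_hom_add[OF \<epsilon>(1) that] by simp_all
  have \<epsilon>_1: "\<epsilon> \<one>\<^bsub>R Quot \<mm>\<^esub> = 1" using ring_hom_one[OF \<epsilon>(1)] by simp
  have "\<exists>H. ring_hom_ring T R H \<and> (\<forall>x\<in>carrier A. H (left x) = \<eta> (x, \<one>\<^bsub>R Quot \<mm>\<^esub>))"
  proof (rule tensor_lift[of \<eta>])
    fix x y B C
    assume xy: "x \<in> carrier A" "y \<in> carrier A" and BC: "B \<in> carrier (R Quot \<mm>)" "C \<in> carrier (R Quot \<mm>)"
    obtain p q where pq: "p \<in> rees_polys" "x = poly.coeff p" "q \<in> rees_polys" "y = poly.coeff q"
      using xy by (auto simp: rees_algebra_simps(1))
    show "\<eta> (x \<otimes>\<^bsub>A\<^esub> y, B \<otimes>\<^bsub>R Quot \<mm>\<^esub> C) = \<eta> (x, B) * \<eta> (y, C)"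
      unfolding pq rees_algebra_simps(2) \<eta> by (simp add: face_eval_mult pq \<epsilon>_simps BC)
  next
    show "\<eta> (\<one>\<^bsub>A\<^esub>, \<one>\<^bsub>R Quot \<mm>\<^esub>) = 1"
      unfolding rees_algebra_simps(4) \<eta> using face_eval_const[of 1] by (simp add: \<epsilon>_1 residue_1 one_pCons)
  next
    fix x y B assume xy: "x \<in> carrier A" "y \<in> carrier A" and B: "B \<in> carrier (R Quot \<mm>)"
    obtain p q where pq: "p \<in> rees_polys" "x = poly.coeff p" "q \<in> rees_polys" "y = poly.coeff q"
      using xy by (auto simp: rees_algebra_simps(1))
    show "\<eta> (x \<oplus>\<^bsub>A\<^esub> y, B) = \<eta> (x, B) + \<eta> (y, B)"
      unfolding pq rees_algebra_simps(3) \<eta> by (simp add: face_eval_add algebra_simps)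
  next
    fix x B C assume x: "x \<in> carrier A" and BC: "B \<in> carrier (R Quot \<mm>)" "C \<in> carrier (R Quot \<mm>)"
    show "\<eta> (x, B \<oplus>\<^bsub>R Quot \<mm>\<^esub> C) = \<eta> (x, B) + \<eta> (x, C)"
      by (simp add: \<eta>_def \<epsilon>_simps BC algebra_simps)
  next
    fix r x B assume x: "x \<in> carrier A" and B: "B \<in> carrier (R Quot \<mm>)"
    obtain p where p: "p \<in> rees_polys" "x = poly.coeff p"
      using x by (auto simp: rees_algebra_simps(1))
    have r: "\<mm> +>\<^bsub>R\<^esub> r \<in> carrier (R Quot \<mm>)"
      using ring_hom_closed[OF ideal.rcos_ring_hom[OF ideal_\<mm>], of r] by simp
    show "\<eta> (up_ring.monom (UP R) r 0 \<otimes>\<^bsub>A\<^esub> x, B) = \<eta> (x, (\<mm> +>\<^bsub>R\<^esub> r) \<otimes>\<^bsub>R Quot \<mm>\<^esub> B)"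
      unfolding p(2) UP_mpoly_ring_simps(6) rees_algebra_simps(2) \<eta>
      unfolding face_eval_mult[OF const_poly_mem p(1)] face_eval_const \<epsilon>_simps(1)[OF r B] \<epsilon>(2)
      by (simp add: ac_simps)
  qed blast
  then obtain H where H: "ring_hom_ring T R H" "\<And>x. x \<in> carrier A \<Longrightarrow> H (left x) = \<eta> (x, \<one>\<^bsub>R Quot \<mm>\<^esub>)"
    by blast
  have "H (left (poly.coeff p)) = face_eval p" if "p \<in> rees_polys" for p
    using H(2)[of "poly.coeff p"] that unfolding \<eta> \<epsilon>_1 by (simp add: rees_algebra_simps(1))
  with H(1) show thesis by (rule that)
qed

text \<open>The variable \<open>v\<close> contributes 1 to one or both of the degrees; powers of
  \<open>x0\<close> and \<open>z0\<close> fill them up to exactly \<open>a\<close> and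
  \<open>b\<close>.\<close>

lemma exists_face_exponent: "\<exists>u. face 1 u \<and> lookup u v \<noteq> 0 \<and> keys u \<subseteq> {v, x0, z0}"
proof -
  let ?s = "\<lambda>v c. Poly_Mapping.single v c :: 'v \<Rightarrow>\<^sub>0 nat"
  have mem: "x0 \<in> X \<union> Y" "x0 \<notin> Y \<union> Z" "z0 \<in> Y \<union> Z" "z0 \<notin> X \<union> Y" using x0 z0 disj by auto
  have keys: "keys (?s v 1 + ?s x0 i + ?s z0 j) \<subseteq> {v, x0, z0}" for i j
    by (rule order_trans[OF Poly_Mapping.keys_add] Un_least)+ auto
  have ne: "lookup (?s v 1 + ?s x0 i + ?s z0 j) v \<noteq> 0" for i j by (simp add: lookup_add)
  consider "v \<in> X" | "v \<in> Y" | "v \<in> Z" using UNIV by blast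
  then obtain i j where "face 1 (?s v 1 + ?s x0 i + ?s z0 j)"
  proof cases
    case 1
    then have "face 1 (?s v 1 + ?s x0 (a - 1) + ?s z0 b)"
      using mem disj a by (auto simp: face_def deg_in_add deg_in_single when_def)
    then show ?thesis by (rule that)
  next
    case 2
    then have "face 1 (?s v 1 + ?s x0 (a - 1) + ?s z0 (b - 1))"
      using mem disj a b by (auto simp: face_def deg_in_add deg_in_single when_def)
    then show ?thesis by (rule that)
  next
    case 3
    then have "face 1 (?s v 1 + ?s x0 a + ?s z0 (b - 1))"
      using mem disj b by (auto simp: face_def deg_in_add deg_in_single when_def)
    then show ?thesis by (rule that)
  qed
  then show ?thesis using keys ne by blast
qed

section \<open>The chain of primes pulled back from ideals of variables\<close>

lemma krull_dim_lower:
  obtains P where "\<And>i. i \<le> card (UNIV :: 'v set) - 1 \<Longrightarrow> primeideal (P i) T"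
    "\<And>i. i < card (UNIV :: 'v set) - 1 \<Longrightarrow> P i \<subset> P (Suc i)"
proof -
  obtain H where H: "ring_hom_ring T R H" "\<And>p. p \<in> rees_polys \<Longrightarrow> H (left (poly.coeff p)) = face_eval p"
    by (rule face_eval_lift) blast
  interpret H: ring_hom_ring T R H by (rule H(1))
  interpret l: ring_hom_ring A T left by (rule left_hom)
  have x0z0: "x0 \<noteq> z0" using x0 z0 disj by blast
  define P where "P J = {t \<in> carrier T. H t \<in> {f. restr (avoiding J) f = 0}}" for J
  have prime: "primeideal (P J) T" for J
    unfolding P_def by (rule H.primeideal_vimage[OF cring_T primeideal_vars])
  have mono: "P J \<subseteq> P J'" if "J \<subseteq> J'" for J J'
    using that unfolding P_def restr_eq_0_iff avoiding_def by blast
  \<comment> \<open>The witness is a monomial on the face involving only \<open>v\<close> and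
    possibly \<open>x0\<close> and \<open>z0\<close>: it vanishes when the variables in
    \<open>J'\<close> are set to 0, but not when only those in \<open>J\<close> are.\<close>
  have strict: "P J \<subset> P J'" if J: "J \<subseteq> J'" "v \<in> J'" "v \<notin> J" "x0 \<notin> J" "z0 \<notin> J" for J J' v
  proof -
    obtain u where u: "face 1 u" "lookup u v \<noteq> 0" "keys u \<subseteq> {v, x0, z0}"
      using exists_face_exponent by blast
    let ?f = "Poly_Mapping.single u 1 :: ('v \<Rightarrow>\<^sub>0 nat) \<Rightarrow>\<^sub>0 'k"
    have mem: "Polynomial.monom ?f 1 \<in> rees_polys"
      using u(1) by (auto simp: rees_polys_def coeff_monom face_def rees_exps_def intro!: mon_ideal_single)
    then have t: "left (poly.coeff (Polynomial.monom ?f 1)) \<in> carrier T"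
      by (intro l.hom_closed) (unfold rees_algebra_simps(1), rule imageI)
    have Ht: "H (left (poly.coeff (Polynomial.monom ?f 1))) = ?f"
      unfolding H(2)[OF mem] face_eval_monom restr_single using u(1) by simp
    have "avoiding J u" using u(3) J(3-5) by (auto simp: avoiding_def in_keys_iff)
    moreover have "\<not> avoiding J' u" using u(2) J(2) by (auto simp: avoiding_def)
    moreover have "?f \<noteq> 0" by (metis lookup_single_eq lookup_zero one_neq_zero)
    ultimately have "left (poly.coeff (Polynomial.monom ?f 1)) \<in> P J' - P J"
      using t unfolding P_def Diff_iff mem_Collect_eq Ht restr_single by simp
    then show ?thesis using mono[OF J(1)] by blast
  qed
  obtain l where l: "set l = UNIV - {x0, z0}" "distinct l"
    using finite_distinct_list[of "UNIV - {x0, z0}"] by auto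
  have len: "length l = card (UNIV :: 'v set) - 2"
    using distinct_card[OF l(2)] x0z0 by (simp add: l(1) card_Diff_subset)
  have two: "2 \<le> card (UNIV :: 'v set)"
    using card_mono[of UNIV "{x0, z0}"] x0z0 by simp
  \<comment> \<open>Up to index \<open>length l\<close>, which is \<open>card UNIV - 2\<close>, the
    sets grow by one variable each and miss \<open>x0\<close> and \<open>z0\<close>; the next and
    last one contains both.\<close>
  define J where "J i = (if i \<le> length l then set (take i l) else UNIV)" for i
  show thesis
  proof (rule that)
    show "primeideal (P (J i)) T" for i by (rule prime)
    fix i assume "i < card (UNIV :: 'v set) - 1"
    then have i: "i \<le> length l" using len two by simp
    then have Ji: "J i = set (take i l)" by (simp add: J_def)
    have sub: "J i \<subseteq> UNIV - {x0, z0}" unfolding Ji using set_take_subset[of i l] l(1) by simp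
    show "P (J i) \<subset> P (J (Suc i))"
    proof (cases "i < length l")
      case True
      have "l ! i \<notin> set (take i l)"
        using l(2) True by (auto simp: in_set_conv_nth nth_eq_iff_index_eq)
      then show ?thesis
        using True sub by (intro strict[of _ _ "l ! i"]) (auto simp: J_def take_Suc_conv_app_nth)
    next
      case False
      then show ?thesis using sub i by (intro strict[of _ _ x0]) (auto simp: J_def)
    qed
  qed
qed

theorem analytic_spread_I: "analytic_spread R \<mm> I = enat (card (UNIV :: 'v set) - 1)"
  unfolding analytic_spread_eq krull_dim_def
proof (rule antisym)
  let ?S = "{enat n |n. \<exists>P. (\<forall>i\<le>n. primeideal (P i) T) \<and> (\<forall>i<n. P i \<subset> P (Suc i))}"
  show "Sup ?S \<le> enat (card (UNIV :: 'v set) - 1)"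
  proof (rule Sup_least)
    fix x assume "x \<in> ?S"
    then obtain N P where N: "x = enat N" "\<forall>i\<le>N. primeideal (P i) T" "\<forall>i<N. P i \<subset> P (Suc i)" by blast
    then have "N < card (UNIV :: 'v set)" by (intro krull_dim_upper[of N P]) auto
    then show "x \<le> enat (card (UNIV :: 'v set) - 1)" using N(1) by simp
  qed
  obtain P where "\<And>i. i \<le> card (UNIV :: 'v set) - 1 \<Longrightarrow> primeideal (P i) T"
    "\<And>i. i < card (UNIV :: 'v set) - 1 \<Longrightarrow> P i \<subset> P (Suc i)"
    by (rule krull_dim_lower) blast
  then show "enat (card (UNIV :: 'v set) - 1) \<le> Sup ?S" by (intro Sup_upper) blast
qed

end

theorem corollary5p16:
  fixes R :: "(('v::finite \<Rightarrow>\<^sub>0 nat) \<Rightarrow>\<^sub>0 'k::field) ring"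
    and V\<^sub>x V\<^sub>y V\<^sub>z :: "'v set"
    and s t r n a b :: nat
    and \<pp> \<qq> \<mm> I :: "(('v \<Rightarrow>\<^sub>0 nat) \<Rightarrow>\<^sub>0 'k) set"
  assumes "infinite (UNIV :: 'k set)"
    and "R = mpoly_ring"
    and "V\<^sub>x \<union> V\<^sub>y \<union> V\<^sub>z = UNIV" and "V\<^sub>x \<inter> V\<^sub>y = {}" and "V\<^sub>x \<inter> V\<^sub>z = {}" and "V\<^sub>y \<inter> V\<^sub>z = {}"
    and "card V\<^sub>x = s" and "card V\<^sub>y = t" and "card V\<^sub>z = r"
    and "s \<ge> 1" and "r \<ge> 1"
    and "n = r + s + t"
    and "\<mm> = Idl\<^bsub>R\<^esub> (range mpoly_var)"
    and "\<pp> = Idl\<^bsub>R\<^esub> (mpoly_var ` (V\<^sub>x \<union> V\<^sub>y))"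
    and "\<qq> = Idl\<^bsub>R\<^esub> (mpoly_var ` (V\<^sub>y \<union> V\<^sub>z))"
    and "a \<ge> 1" and "b \<ge> 1"
    and "I = ideal_power R \<pp> a \<inter> ideal_power R \<qq> b"
  shows "analytic_spread R \<mm> I = enat (n - 1)"
proof -
  obtain x0 z0 where x0: "x0 \<in> V\<^sub>x" and z0: "z0 \<in> V\<^sub>z"
    using assms(7,9,10,11) by (metis One_nat_def card.empty ex_in_conv not_one_le_zero)
  have power: "ideal_power mpoly_ring I k = mon_ideal (rees_exps (V\<^sub>x \<union> V\<^sub>y) (V\<^sub>y \<union> V\<^sub>z) a b k)" for k
    by (rule ideal_power_rees_exps[OF assms(4-6)]) (use assms in simp)
  interpret two_primes_ideal V\<^sub>x V\<^sub>y V\<^sub>z a b x0 z0 I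
    by unfold_locales (use assms(3-6,16,17) x0 z0 power in auto)
  have "card (UNIV :: 'v set) = card (V\<^sub>x \<union> V\<^sub>y) + card V\<^sub>z"
    unfolding assms(3)[symmetric] using assms(5,6) by (intro card_Un_disjoint) auto
  also have "card (V\<^sub>x \<union> V\<^sub>y) = card V\<^sub>x + card V\<^sub>y"
    using assms(4) by (intro card_Un_disjoint) auto
  finally have "card (UNIV :: 'v set) = n" using assms(7-9,12) by simp
  then show ?thesis using analytic_spread_I unfolding assms(2,13) by simp
qed

end
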